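(* Let $k\ge 3$ and $1\le j\le k-1$ be fixed integers. In the random $k$-uniform hypergraph process $\{\mathcal{H}^k(n,M)\}_M$ on vertex set $\{1,\ldots,n\}$, let $\tau_c=\tau_c(n,j,k)$ be the first step $M$ at which $\mathcal{H}^k(n,M)$ is $j$-connected, and let $\tau_i=\tau_i(n,j,k)$ be the first step $M$ at which $\mathcal{H}^k(n,M)$ has no isolated $j$-set. Then with high probability (i.e.\ with probability tending to $1$ as $n\to\infty$) we have $\tau_c=\tau_i$.
   Context: A $k$-uniform hypergraph consists of a vertex set $V$ and a set of edges, each edge being a $k$-element subset of $V$. The random hypergraph process $\{\mathcal{H}^k(n,M)\}_M$ is defined by: $\mathcal{H}^k(n,0)$ is the hypergraph on $\{1,\ldots,n\}$ with no edges, and for $1\le M\le\binom{n}{k}$, $\mathcal{H}^k(n,M)$ is obtained from $\mathcal{H}^k(n,M-1)$ by adding a $k$-set chosen uniformly at random among those not already present as edges. A $j$-set is a set of $j$ vertices. Two $j$-sets $J_1,J_2$ are $j$-connected if there is a sequence of edges $E_1,\ldots,E_m$ with $J_1\subseteq E_1$, $J_2\subseteq E_m$ and $|E_i\cap E_{i+1}|\ge j$ for all $1\le i\le m-1$. A $j$-component is a maximal set of pairwise $j$-connected $j$-sets. A hypergraph is $j$-connected if there is one $j$-component which contains all $j$-sets of vertices. A $j$-set is isolated if it is contained in no edge. Both properties are monotone increasing, so $\tau_c,\tau_i$ are well defined. *)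

theory Defs
  imports "HOL-Probability.Probability"
begin

definition subsets_of_size :: "nat \<Rightarrow> 'a set \<Rightarrow> 'a set set" where
  "subsets_of_size k V = {A. A \<subseteq> V \<and> card A = k}"

text \<open>A hypergraph is given by its vertex set \<open>V\<close> and its edge set \<open>H\<close>.\<close>

definition j_connected_pair :: "nat \<Rightarrow> 'a set set \<Rightarrow> 'a set \<Rightarrow> 'a set \<Rightarrow> bool" where
  "j_connected_pair j H J1 J2 \<longleftrightarrow>
     (\<exists>Es. Es \<noteq> [] \<and> set Es \<subseteq> H \<and> J1 \<subseteq> hd Es \<and> J2 \<subseteq> last Es \<and>
           (\<forall>i. Suc i < length Es \<longrightarrow> j \<le> card (Es ! i \<inter> Es ! Suc i)))"

text \<open>The library notion \<^const>\<open>pairwise\<close> only concerns distinct elements, so an isolated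
  \<open>j\<close>-set forms a component on its own.\<close>

definition j_component :: "nat \<Rightarrow> 'a set \<Rightarrow> 'a set set \<Rightarrow> 'a set set \<Rightarrow> bool" where
  "j_component j V H C \<longleftrightarrow>
     C \<subseteq> subsets_of_size j V \<and> pairwise (j_connected_pair j H) C \<and>
     (\<forall>D. C \<subseteq> D \<and> D \<subseteq> subsets_of_size j V \<and> pairwise (j_connected_pair j H) D \<longrightarrow> D = C)"

definition j_connected :: "nat \<Rightarrow> 'a set \<Rightarrow> 'a set set \<Rightarrow> bool" where
  "j_connected j V H \<longleftrightarrow> (\<exists>C. j_component j V H C \<and> subsets_of_size j V \<subseteq> C)"

definition isolated :: "'a set set \<Rightarrow> 'a set \<Rightarrow> bool" where
  "isolated H J \<longleftrightarrow> \<not> (\<exists>E\<in>H. J \<subseteq> E)"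

definition no_isolated :: "nat \<Rightarrow> 'a set \<Rightarrow> 'a set set \<Rightarrow> bool" where
  "no_isolated j V H \<longleftrightarrow> \<not> (\<exists>J\<in>subsets_of_size j V. isolated H J)"

text \<open>The first \<open>M\<close> steps of the process are represented by the list of the edges added, in order.
  This is meaningful only for \<open>M \<le> n choose k\<close>: afterwards \<^const>\<open>pmf_of_set\<close> is applied to
  the empty set.\<close>

primrec hypergraph_steps :: "nat \<Rightarrow> nat \<Rightarrow> nat \<Rightarrow> nat set list pmf" where
  "hypergraph_steps k n 0 = return_pmf []"
| "hypergraph_steps k n (Suc M) =
     bind_pmf (hypergraph_steps k n M) (\<lambda>es.
       map_pmf (\<lambda>e. es @ [e]) (pmf_of_set (subsets_of_size k {1..n} - set es)))"

definition hypergraph_process :: "nat \<Rightarrow> nat \<Rightarrow> nat set list pmf" where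
  "hypergraph_process k n = hypergraph_steps k n (n choose k)"

definition hypergraph_at :: "nat set list \<Rightarrow> nat \<Rightarrow> nat set set" where
  "hypergraph_at es M = set (take M es)"

text \<open>The hitting times, as functions of an outcome \<open>es\<close> of the process. If \<open>n \<ge> k\<close>, both
  properties hold at the final step \<open>M = n choose k\<close>; for \<open>n < k\<close> they may never hold and the
  values are then unspecified.\<close>

definition tau_c :: "nat \<Rightarrow> nat \<Rightarrow> nat set list \<Rightarrow> nat" where
  "tau_c n j es = (LEAST M. j_connected j {1..n} (hypergraph_at es M))"

definition tau_i :: "nat \<Rightarrow> nat \<Rightarrow> nat set list \<Rightarrow> nat" where
  "tau_i n j es = (LEAST M. no_isolated j {1..n} (hypergraph_at es M))"

end

theory Submission
  imports Defs "HOL-Real_Asymp.Real_Asymp"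
begin

text \<open>The link of a \<open>(j - 1)\<close>-set \<open>I\<close> is a \<open>(k - j + 1)\<close>-uniform hypergraph on the other vertices. If all
  links are connected in the ordinary vertex sense, the hypergraph is \<open>j\<close>-connected, because any two
  \<open>j\<close>-sets are joined by exchanging one vertex at a time. Isolated vertices of links are isolated
  \<open>j\<close>-sets, so it suffices to exclude, by a union bound over all \<open>I\<close>, vertex sets \<open>S\<close> with
  \<open>2 \<le> |S| \<le> (n - j + 1) / 2\<close> that no edge of the link leaves at time \<open>\<tau>\<^sub>i\<close>.

  Fix times \<open>M0 \<le> M1\<close> around the threshold. By the second moment method there is an isolated
  \<open>j\<close>-set at time \<open>M0\<close> with high probability, and by the first moment method there is none at time
  \<open>M1\<close>; so \<open>M0 \<le> \<tau>\<^sub>i \<le> M1\<close>. A bad set \<open>S\<close> is then left by no edge at time \<open>M0\<close>, and contains an edge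
  of the link at time \<open>M1\<close>. For \<open>|S|\<close> below the fourth root of \<open>n - j + 1\<close> the presence of this edge
  supplies the small factor in the union bound (needed when \<open>j = 1\<close>); for larger \<open>S\<close> the absence of
  leaving edges suffices.\<close>

section \<open>Sampling without replacement\<close>

text \<open>The edge process over an arbitrary ground set, so that avoiding or hitting sets of edges
  can be studied without the hypergraph structure.\<close>

primrec draws :: "'a set \<Rightarrow> nat \<Rightarrow> 'a list pmf" where
  "draws U 0 = return_pmf []"
| "draws U (Suc M) =
     bind_pmf (draws U M) (\<lambda>es. map_pmf (\<lambda>e. es @ [e]) (pmf_of_set (U - set es)))"

lemma hypergraph_steps_eq_draws: "hypergraph_steps k n M = draws (subsets_of_size k {1..n}) M"
  by (induction M) simp_all

lemma prob_bind_pmf: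
  "measure_pmf.prob (bind_pmf p f) X = measure_pmf.expectation p (\<lambda>x. measure_pmf.prob (f x) X)"
proof -
  have "ennreal (measure_pmf.prob (bind_pmf p f) X) = (\<integral>\<^sup>+x. ennreal (measure_pmf.prob (f x) X) \<partial>p)"
    by (simp flip: measure_pmf.emeasure_eq_measure)
  also have "\<dots> = ennreal (measure_pmf.expectation p (\<lambda>x. measure_pmf.prob (f x) X))"
    by (intro nn_integral_eq_integral measure_pmf.integrable_const_bound[where B = 1]) auto
  finally show ?thesis
    by (subst (asm) ennreal_inj) (auto intro!: integral_nonneg_AE)
qed

lemma integrable_pmf_bounded:
  "(\<And>x. \<bar>f x\<bar> \<le> b) \<Longrightarrow> integrable (measure_pmf p) (f :: 'a \<Rightarrow> real)"
  by (intro measure_pmf.integrable_const_bound[where B = b]) auto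

lemma integrable_pmf_indicator: "integrable (measure_pmf p) (indicator X :: 'a \<Rightarrow> real)"
  by (rule integrable_pmf_bounded[where b = 1]) (simp add: indicator_def)

lemma integrable_pmf_prob:
  "integrable (measure_pmf p) (\<lambda>x. measure_pmf.prob (f x) (X x))"
  by (rule integrable_pmf_bounded[where b = 1]) simp

lemma set_pmf_draws:
  assumes "finite U" "M \<le> card U" "es \<in> set_pmf (draws U M)"
  shows "distinct es \<and> set es \<subseteq> U \<and> length es = M"
  using assms(2,3)
proof (induction M arbitrary: es)
  case (Suc M)
  from Suc.prems(2) obtain xs e where xs: "xs \<in> set_pmf (draws U M)"
    and e: "e \<in> set_pmf (pmf_of_set (U - set xs))" and es: "es = xs @ [e]" by auto
  have ih: "distinct xs" "set xs \<subseteq> U" "length xs = M"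
    using Suc.IH[OF _ xs] Suc.prems(1) by auto
  have "card (U - set xs) = card U - M"
    using ih assms(1) by (simp add: card_Diff_subset distinct_card)
  hence "U - set xs \<noteq> {}" using Suc.prems(1) by force
  hence "e \<in> U - set xs" using e assms(1) by (subst (asm) set_pmf_of_set) auto
  thus ?case using ih es by auto
qed simp

text \<open>Later draws only append to the list, so cutting it back to \<open>M\<close> entries
  forgets them. Hence an event about an early time can be computed with that many draws
  only.\<close>

lemma map_take_draws:
  assumes "finite U" "M \<le> M'" "M' \<le> card U"
  shows "map_pmf (take M) (draws U M') = draws U M"
  using assms(2,3)
proof (induction M' rule: dec_induct)
  case base
  have "map_pmf (take M) (draws U M) = map_pmf id (draws U M)"
    using set_pmf_draws[OF assms(1) base] by (intro map_pmf_cong) auto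
  thus ?case by simp
next
  case (step M')
  have "map_pmf (take M) (draws U (Suc M'))
      = bind_pmf (draws U M') (\<lambda>es. map_pmf (\<lambda>e. take M (es @ [e])) (pmf_of_set (U - set es)))"
    by (simp add: map_bind_pmf pmf.map_comp o_def)
  also have "\<dots> = bind_pmf (draws U M') (\<lambda>es. return_pmf (take M es))"
  proof (rule bind_pmf_cong[OF refl])
    fix es assume "es \<in> set_pmf (draws U M')"
    hence "length es = M'" using set_pmf_draws[OF assms(1)] step.prems by simp
    thus "map_pmf (\<lambda>e. take M (es @ [e])) (pmf_of_set (U - set es)) = return_pmf (take M es)"
      using step.hyps by simp
  qed
  also have "\<dots> = map_pmf (take M) (draws U M')" by (simp add: map_pmf_def)
  finally show ?case using step by simp
qed

lemma prob_take_draws: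
  assumes "finite U" "M \<le> M'" "M' \<le> card U"
  shows "measure_pmf.prob (draws U M') {es. P (take M es)} = measure_pmf.prob (draws U M) {es. P es}"
  by (simp flip: map_take_draws[OF assms] add: vimage_def)

lemma prob_draws_Suc:
  "measure_pmf.prob (draws U (Suc M)) {es. P es}
     = measure_pmf.expectation (draws U M)
         (\<lambda>es. measure_pmf.prob (pmf_of_set (U - set es)) {e. P (es @ [e])})"
  by (simp add: prob_bind_pmf vimage_def)

lemma prob_draw_next:
  assumes "finite U" "M < card U" "es \<in> set_pmf (draws U M)"
  shows "measure_pmf.prob (pmf_of_set (U - set es)) X
           = card ((U - set es) \<inter> X) / (real (card U) - real M)"
proof -
  have es: "distinct es" "set es \<subseteq> U" "length es = M"
    using set_pmf_draws[OF assms(1) _ assms(3)] assms(2) by auto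
  have c: "card (U - set es) = card U - M"
    using es assms(1) by (simp add: card_Diff_subset distinct_card)
  hence "U - set es \<noteq> {}" using assms(2) by force
  with assms(1,2) c show ?thesis
    by (subst measure_pmf_of_set) (auto simp: of_nat_diff)
qed

text \<open>As long as \<open>A\<close> has been missed, all of its elements are still among the
  \<open>card U - M\<close> undrawn ones.\<close>

lemma prob_draw_next_avoid:
  assumes "finite U" "M < card U" "es \<in> set_pmf (draws U M)" "A \<subseteq> U" "set es \<inter> A = {}"
  shows "measure_pmf.prob (pmf_of_set (U - set es)) (- A)
           = 1 - real (card A) / (real (card U) - real M)"
proof -
  have es: "distinct es" "set es \<subseteq> U" "length es = M"
    using set_pmf_draws[OF assms(1) _ assms(3)] assms(2) by auto
  have "(U - set es) \<inter> - A = U - (set es \<union> A)" by auto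
  moreover have "card (set es \<union> A) = M + card A"
    using es assms finite_subset[OF assms(4)] by (simp add: card_Un_disjoint distinct_card)
  moreover have "card (set es \<union> A) \<le> card U"
    using es assms by (intro card_mono) auto
  ultimately have "real (card ((U - set es) \<inter> - A)) = real (card U) - real M - real (card A)"
    using es assms by (simp add: card_Diff_subset finite_subset[OF assms(4)] of_nat_diff)
  thus ?thesis using assms(2) by (simp add: prob_draw_next[OF assms(1-3)] field_simps)
qed

lemma prob_draws_avoid_Suc:
  assumes "finite U" "M < card U" "A \<subseteq> U"
  shows "measure_pmf.prob (draws U (Suc M)) {es. set es \<inter> A = {}}
           = measure_pmf.prob (draws U M) {es. set es \<inter> A = {}}
             * (1 - real (card A) / (real (card U) - real M))" (is "_ = ?p * ?c")
proof -
  have "measure_pmf.prob (draws U (Suc M)) {es. set es \<inter> A = {}}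
      = measure_pmf.expectation (draws U M) (\<lambda>es. indicator {es. set es \<inter> A = {}} es * ?c)"
    unfolding prob_draws_Suc
  proof (rule integral_cong_AE, simp, simp, rule AE_pmfI)
    fix es assume es: "es \<in> set_pmf (draws U M)"
    show "measure_pmf.prob (pmf_of_set (U - set es)) {e. set (es @ [e]) \<inter> A = {}}
       = indicator {es. set es \<inter> A = {}} es * ?c"
    proof (cases "set es \<inter> A = {}")
      case True
      hence "{e. set (es @ [e]) \<inter> A = {}} = - A" by auto
      thus ?thesis using prob_draw_next_avoid[OF assms(1,2) es assms(3) True] True by simp
    next
      case False
      hence *: "{e. set (es @ [e]) \<inter> A = {}} = {}" by auto
      show ?thesis unfolding * using False by simp
    qed
  qed
  also have "\<dots> = ?p * ?c" by simp
  finally show ?thesis .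
qed

lemma prob_draws_avoid:
  assumes "finite U" "M \<le> card U" "A \<subseteq> U"
  shows "measure_pmf.prob (draws U M) {es. set es \<inter> A = {}}
           = (\<Prod>i<M. 1 - real (card A) / (real (card U) - real i))"
  using assms(2)
proof (induction M)
  case (Suc M)
  thus ?case using prob_draws_avoid_Suc[OF assms(1) _ assms(3), of M] by (simp add: mult.commute)
qed simp

text \<open>The pool of undrawn elements shrinks, so each factor is at most
  \<open>exp (- card A / card U)\<close>, the bound for sampling with replacement.\<close>

lemma prob_draws_avoid_le:
  assumes "finite U" "M \<le> card U" "A \<subseteq> U"
  shows "measure_pmf.prob (draws U M) {es. set es \<inter> A = {}}
           \<le> exp (- (real (card A) * real M / real (card U)))"
  using assms(2)
proof (induction M)
  case (Suc M)
  have N: "real (card U) - real M > 0" using Suc.prems by simp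
  have "1 - real (card A) / (real (card U) - real M) \<le> exp (- (real (card A) / (real (card U) - real M)))"
    using exp_ge_add_one_self[of "- (real (card A) / (real (card U) - real M))"] by simp
  also have "\<dots> \<le> exp (- (real (card A) / real (card U)))"
    using N by (simp add: divide_left_mono)
  finally have "measure_pmf.prob (draws U (Suc M)) {es. set es \<inter> A = {}}
      \<le> exp (- (real (card A) * real M / real (card U))) * exp (- (real (card A) / real (card U)))"
    unfolding prob_draws_avoid_Suc[OF assms(1) Suc_le_lessD[OF Suc.prems] assms(3)]
    using Suc.IH Suc.prems
    by (intro order.trans[OF mult_left_mono mult_right_mono]) auto
  also have "\<dots> = exp (- (real (card A) * real (Suc M) / real (card U)))"
    by (simp add: algebra_simps add_divide_distrib flip: exp_add)
  finally show ?case .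
qed simp

text \<open>Given that \<open>A\<close> is avoided, the draws are a uniform sample from
  \<open>U - A\<close>, so hitting \<open>E\<close> has conditional probability of order
  \<open>M' / card U\<close>. The induction carries this out step by step: a draw hits
  \<open>E\<close> with probability \<open>1 / (card U - M')\<close>, which is the conditional
  avoidance factor divided by \<open>card U - M' - card A\<close>. The fixed upper bound
  \<open>M\<close> on the time keeps the denominator constant during the induction.\<close>

lemma prob_draws_hit_avoid_self:
  assumes "finite U" "M + card A < card U" "A \<subseteq> U" "E \<in> U" "E \<notin> A" "M' \<le> M"
  shows "measure_pmf.prob (draws U M') {es. set es \<inter> A = {} \<and> E \<in> set es}
           \<le> measure_pmf.prob (draws U M') {es. set es \<inter> A = {}}
              * (real M' / (real (card U) - real M - real (card A)))"
  using assms(6)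
proof (induction M')
  case (Suc M')
  let ?K = "real (card U) - real M - real (card A)"
  let ?c = "1 - real (card A) / (real (card U) - real M')"
  let ?p = "\<lambda>M. measure_pmf.prob (draws U M) {es. set es \<inter> A = {}}"
  let ?q = "\<lambda>M. measure_pmf.prob (draws U M) {es. set es \<inter> A = {} \<and> E \<in> set es}"
  have lt: "M' < card U" using Suc.prems assms(2) by simp
  have K: "?K > 0" using assms(2) by linarith
  have N: "real (card U) - real M' > 0" "?K \<le> real (card U) - real M' - real (card A)"
    using Suc.prems lt by auto
  have "?q (Suc M') \<le> measure_pmf.expectation (draws U M')
      (\<lambda>es. indicator {es. set es \<inter> A = {} \<and> E \<in> set es} es * ?c
          + indicator {es. set es \<inter> A = {}} es * (1 / (real (card U) - real M')))"
    unfolding prob_draws_Suc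
  proof (rule integral_mono_AE)
    show "AE es in measure_pmf (draws U M'). measure_pmf.prob (pmf_of_set (U - set es))
             {e. set (es @ [e]) \<inter> A = {} \<and> E \<in> set (es @ [e])}
      \<le> indicator {es. set es \<inter> A = {} \<and> E \<in> set es} es * ?c
          + indicator {es. set es \<inter> A = {}} es * (1 / (real (card U) - real M'))"
    proof (rule AE_pmfI)
      fix es assume es: "es \<in> set_pmf (draws U M')"
      consider "set es \<inter> A \<noteq> {}" | "set es \<inter> A = {}" "E \<in> set es" | "set es \<inter> A = {}" "E \<notin> set es"
        by blast
      thus "measure_pmf.prob (pmf_of_set (U - set es))
             {e. set (es @ [e]) \<inter> A = {} \<and> E \<in> set (es @ [e])}
      \<le> indicator {es. set es \<inter> A = {} \<and> E \<in> set es} es * ?c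
          + indicator {es. set es \<inter> A = {}} es * (1 / (real (card U) - real M'))"
      proof cases
        case 1
        hence *: "{e. set (es @ [e]) \<inter> A = {} \<and> E \<in> set (es @ [e])} = {}" by auto
        show ?thesis unfolding * using 1 by simp
      next
        case 2
        hence *: "{e. set (es @ [e]) \<inter> A = {} \<and> E \<in> set (es @ [e])} = - A" by auto
        show ?thesis unfolding * prob_draw_next_avoid[OF assms(1) lt es assms(3) 2(1)] using 2 N by simp
      next
        case 3
        hence "{e. set (es @ [e]) \<inter> A = {} \<and> E \<in> set (es @ [e])} \<subseteq> {E}" by auto
        hence "measure_pmf.prob (pmf_of_set (U - set es))
             {e. set (es @ [e]) \<inter> A = {} \<and> E \<in> set (es @ [e])} \<le> measure_pmf.prob (pmf_of_set (U - set es)) {E}"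
          by (intro measure_pmf.finite_measure_mono) auto
        also have "\<dots> \<le> 1 / (real (card U) - real M')"
          unfolding prob_draw_next[OF assms(1) lt es] using N
          by (auto intro!: divide_right_mono simp: Int_insert_right)
        finally show ?thesis using 3 by simp
      qed
    qed
  qed (intro Bochner_Integration.integrable_add integrable_mult_left
         integrable_pmf_indicator integrable_pmf_prob)+
  also have "\<dots> = ?q M' * ?c + ?p M' * (1 / (real (card U) - real M'))"
    by (subst Bochner_Integration.integral_add)
       (auto intro!: integrable_mult_left integrable_pmf_indicator)
  also have "\<dots> \<le> ?p M' * (real M' / ?K) * ?c + ?p M' * (?c / ?K)"
  proof (intro add_mono mult_right_mono mult_left_mono)
    show "?q M' \<le> ?p M' * (real M' / ?K)" using Suc by simp
    have c: "?c = (real (card U) - real M' - real (card A)) / (real (card U) - real M')"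
      using N by (simp add: field_simps)
    have "1 / (real (card U) - real M') = ?K / (real (card U) - real M') / ?K"
      using K by simp
    also have "\<dots> \<le> ?c / ?K"
      unfolding c using N K by (intro divide_right_mono) auto
    finally show "1 / (real (card U) - real M') \<le> ?c / ?K" .
    show "0 \<le> ?c" using N K by (simp add: field_simps)
  qed auto
  also have "\<dots> = ?p (Suc M') * (real (Suc M') / ?K)"
  proof -
    have "p * (a / K) * c + p * (c / K) = p * c * ((1 + a) / K)" for p a c K :: real
      by (simp add: add_divide_distrib distrib_left mult_ac)
    thus ?thesis
      unfolding prob_draws_avoid_Suc[OF assms(1) lt assms(3)] of_nat_Suc by blast
  qed
  finally show ?case .
qed simp

text \<open>Up to time \<open>M\<close> the preceding lemma applies. Afterwards avoidance is no
  longer demanded, and each further draw adds at most the probability of avoidance up to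
  \<open>M\<close> times the chance of drawing \<open>E\<close> in that step.\<close>

lemma prob_draws_hit_avoid:
  assumes "finite U" "M' + card A < card U" "A \<subseteq> U" "E \<in> U" "E \<notin> A" "M \<le> M'"
  shows "measure_pmf.prob (draws U M') {es. set (take M es) \<inter> A = {} \<and> E \<in> set es}
           \<le> measure_pmf.prob (draws U M) {es. set es \<inter> A = {}}
              * (real M' / (real (card U) - real M' - real (card A)))"
proof -
  let ?K = "real (card U) - real M' - real (card A)"
  let ?p = "measure_pmf.prob (draws U M) {es. set es \<inter> A = {}}"
  let ?q = "\<lambda>L. measure_pmf.prob (draws U L) {es. set (take M es) \<inter> A = {} \<and> E \<in> set es}"
  have K: "?K > 0" using assms(2) by linarith
  have "?q L \<le> ?p * (real L / ?K)" if "M \<le> L" "L \<le> M'" for L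
    using that
  proof (induction L rule: dec_induct)
    case base
    have "?q M = measure_pmf.prob (draws U M) {es. set es \<inter> A = {} \<and> E \<in> set es}"
    proof (intro measure_pmf.finite_measure_eq_AE AE_pmfI)
      fix es assume "es \<in> set_pmf (draws U M)"
      hence "length es = M" using set_pmf_draws[OF assms(1)] assms by simp
      thus "(es \<in> {es. set (take M es) \<inter> A = {} \<and> E \<in> set es})
        = (es \<in> {es. set es \<inter> A = {} \<and> E \<in> set es})" by simp
    qed auto
    thus ?case using prob_draws_hit_avoid_self[OF assms(1-5)] base by simp
  next
    case (step L)
    have lt: "L < card U" using step assms(2) by simp
    have N: "real (card U) - real L > 0" "?K \<le> real (card U) - real L" using lt step by auto
    have "?q (Suc L) \<le> measure_pmf.expectation (draws U L)
      (\<lambda>es. indicator {es. set (take M es) \<inter> A = {} \<and> E \<in> set es} es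
          + indicator {es. set (take M es) \<inter> A = {}} es * (1 / (real (card U) - real L)))"
      unfolding prob_draws_Suc
    proof (rule integral_mono_AE)
      show "AE es in measure_pmf (draws U L). measure_pmf.prob (pmf_of_set (U - set es))
             {e. set (take M (es @ [e])) \<inter> A = {} \<and> E \<in> set (es @ [e])}
      \<le> indicator {es. set (take M es) \<inter> A = {} \<and> E \<in> set es} es
          + indicator {es. set (take M es) \<inter> A = {}} es * (1 / (real (card U) - real L))"
      proof (rule AE_pmfI)
        fix es assume es: "es \<in> set_pmf (draws U L)"
        hence t: "take M (es @ [e]) = take M es" for e
          using set_pmf_draws[OF assms(1) _ es] lt step by simp
        show "measure_pmf.prob (pmf_of_set (U - set es))
             {e. set (take M (es @ [e])) \<inter> A = {} \<and> E \<in> set (es @ [e])}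
      \<le> indicator {es. set (take M es) \<inter> A = {} \<and> E \<in> set es} es
          + indicator {es. set (take M es) \<inter> A = {}} es * (1 / (real (card U) - real L))"
        proof (cases "set (take M es) \<inter> A = {} \<and> E \<notin> set es")
          case True
          hence "{e. set (take M (es @ [e])) \<inter> A = {} \<and> E \<in> set (es @ [e])} \<subseteq> {E}" by auto
          hence "measure_pmf.prob (pmf_of_set (U - set es))
             {e. set (take M (es @ [e])) \<inter> A = {} \<and> E \<in> set (es @ [e])} \<le> measure_pmf.prob (pmf_of_set (U - set es)) {E}"
            by (intro measure_pmf.finite_measure_mono) auto
          also have "\<dots> \<le> 1 / (real (card U) - real L)"
            unfolding prob_draw_next[OF assms(1) lt es] using N
            by (auto intro!: divide_right_mono simp: Int_insert_right)
          finally show ?thesis using True by simp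
        next
          case False
          show ?thesis
          proof (cases "set (take M es) \<inter> A = {}")
            case True
            thus ?thesis using False N by (auto intro!: order.trans[OF measure_pmf.prob_le_1])
          next
            case False
            hence *: "{e. set (take M (es @ [e])) \<inter> A = {} \<and> E \<in> set (es @ [e])} = {}"
              unfolding t by auto
            show ?thesis unfolding * using N by simp
          qed
        qed
      qed
    qed (intro Bochner_Integration.integrable_add integrable_mult_left
         integrable_pmf_indicator integrable_pmf_prob)+
    also have "\<dots> = ?q L + measure_pmf.prob (draws U L) {es. set (take M es) \<inter> A = {}}
                              * (1 / (real (card U) - real L))"
      by (subst Bochner_Integration.integral_add)
         (auto intro!: integrable_mult_left integrable_pmf_indicator)
    also have "\<dots> = ?q L + ?p * (1 / (real (card U) - real L))"
      using prob_take_draws[OF assms(1), of M L "\<lambda>es. set es \<inter> A = {}"] step lt by simp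
    also have "\<dots> \<le> ?p * (real L / ?K) + ?p * (1 / ?K)"
      using step N K by (intro add_mono mult_left_mono divide_left_mono) auto
    also have "\<dots> = ?p * (real (Suc L) / ?K)" by (simp add: algebra_simps add_divide_distrib)
    finally show ?case .
  qed
  from this[OF assms(6) order.refl] show ?thesis .
qed

section \<open>Second moment method and estimates for products of avoidance factors\<close>

lemma second_moment:
  fixes p :: "'a pmf" and B :: "'i \<Rightarrow> 'a set"
  assumes "finite I" "I \<noteq> {}" "a > 0"
    and single: "\<And>i. i \<in> I \<Longrightarrow> measure_pmf.prob p (B i) = a"
    and pair: "\<And>i i'. i \<in> I \<Longrightarrow> i' \<in> I \<Longrightarrow> i \<noteq> i' \<Longrightarrow> measure_pmf.prob p (B i \<inter> B i') \<le> c * a\<^sup>2"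
    and "c \<ge> 0"
  shows "measure_pmf.prob p {x. \<forall>i\<in>I. x \<notin> B i} \<le> 1 / (real (card I) * a) + (c - 1)"
proof -
  define X where "X x = (\<Sum>i\<in>I. indicator (B i) x :: real)" for x
  define \<mu> where "\<mu> = real (card I) * a"
  have \<mu>: "\<mu> > 0" using assms by (simp add: \<mu>_def card_gt_0_iff)
  have Xb: "\<bar>X x\<bar> \<le> real (card I)" for x
  proof -
    have "\<bar>X x\<bar> \<le> (\<Sum>i\<in>I. 1)" unfolding X_def
      by (intro order.trans[OF sum_abs] sum_mono) (auto simp: indicator_def)
    thus ?thesis by simp
  qed
  have intX: "integrable (measure_pmf p) X" by (rule integrable_pmf_bounded[OF Xb])
  have intX2: "integrable (measure_pmf p) (\<lambda>x. (X x)\<^sup>2)"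
    by (rule integrable_pmf_bounded[where b = "(real (card I))\<^sup>2"]) (use Xb power_mono[of "\<bar>X _\<bar>" "real (card I)" 2] in auto)
  have EX: "measure_pmf.expectation p X = \<mu>"
    unfolding X_def using single
    by (subst Bochner_Integration.integral_sum) (auto intro!: integrable_pmf_bounded[where b = 1] simp: \<mu>_def)
  have "measure_pmf.expectation p (\<lambda>x. (X x)\<^sup>2)
      = measure_pmf.expectation p (\<lambda>x. \<Sum>i\<in>I. \<Sum>i'\<in>I. indicator (B i \<inter> B i') x)"
    unfolding X_def by (simp add: power2_eq_square sum_product indicator_inter_arith)
  also have "\<dots> = (\<Sum>i\<in>I. \<Sum>i'\<in>I. measure_pmf.prob p (B i \<inter> B i'))"
    by (simp add: Bochner_Integration.integral_sum integrable_pmf_indicator)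
  also have "\<dots> \<le> (\<Sum>i\<in>I. \<Sum>i'\<in>I. c * a\<^sup>2 + (if i = i' then a else 0))"
  proof (intro sum_mono)
    fix i i' assume "i \<in> I" "i' \<in> I"
    thus "measure_pmf.prob p (B i \<inter> B i') \<le> c * a\<^sup>2 + (if i = i' then a else 0)"
      using single pair \<open>c \<ge> 0\<close> by (cases "i = i'") auto
  qed
  also have "\<dots> = c * \<mu>\<^sup>2 + \<mu>"
    using assms(1) by (simp add: sum.distrib \<mu>_def power2_eq_square algebra_simps)
  finally have EX2: "measure_pmf.expectation p (\<lambda>x. (X x)\<^sup>2) \<le> c * \<mu>\<^sup>2 + \<mu>" .
  \<comment> \<open>Chebyshev's inequality at the value 0: on this event \<open>X\<close> vanishes,
    so \<open>(X - \<mu>)^2\<close> equals \<open>\<mu>^2\<close> there, and the expectation of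
    \<open>(X - \<mu>)^2\<close> is the variance.\<close>
  have "\<mu>\<^sup>2 * measure_pmf.prob p {x. \<forall>i\<in>I. x \<notin> B i}
      = measure_pmf.expectation p (\<lambda>x. \<mu>\<^sup>2 * indicator {x. \<forall>i\<in>I. x \<notin> B i} x)" by simp
  also have "\<dots> \<le> measure_pmf.expectation p (\<lambda>x. (X x)\<^sup>2 - 2 * \<mu> * X x + \<mu>\<^sup>2)"
  proof (rule integral_mono_AE)
    show "AE x in measure_pmf p. \<mu>\<^sup>2 * indicator {x. \<forall>i\<in>I. x \<notin> B i} x \<le> (X x)\<^sup>2 - 2 * \<mu> * X x + \<mu>\<^sup>2"
    proof (rule AE_pmfI)
      fix x
      have "(X x)\<^sup>2 - 2 * \<mu> * X x + \<mu>\<^sup>2 = (X x - \<mu>)\<^sup>2" by (simp add: power2_eq_square algebra_simps)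
      moreover have "X x = 0" if "\<forall>i\<in>I. x \<notin> B i" using that by (simp add: X_def)
      ultimately show "\<mu>\<^sup>2 * indicator {x. \<forall>i\<in>I. x \<notin> B i} x \<le> (X x)\<^sup>2 - 2 * \<mu> * X x + \<mu>\<^sup>2"
        by (auto simp: indicator_def)
    qed
  qed (use intX intX2 in \<open>auto intro!: integrable_pmf_indicator\<close>)
  also have "\<dots> = measure_pmf.expectation p (\<lambda>x. (X x)\<^sup>2) - \<mu>\<^sup>2"
    using intX intX2 by (simp add: EX power2_eq_square)
  also have "\<dots> \<le> c * \<mu>\<^sup>2 + \<mu> - \<mu>\<^sup>2" using EX2 by simp
  also have "\<dots> = \<mu>\<^sup>2 * (1 / \<mu> + (c - 1))"
    using \<mu> by (simp add: field_simps power2_eq_square)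
  finally show ?thesis
    using \<mu> by (simp only: mult_le_cancel_left_pos zero_less_power flip: \<mu>_def)
qed

text \<open>With \<open>z = N - i\<close>, the factor \<open>1 - D / z\<close> is the inverse of
  \<open>1 + D / (z - D)\<close>, hence at least \<open>exp (- D / (z - D))\<close>; the smallest
  \<open>z - D\<close> that can occur exceeds \<open>N - M - D\<close>.\<close>

lemma prod_one_minus_ge_exp:
  fixes N D :: real
  assumes "0 \<le> D" "real M + D < N"
  shows "exp (- (real M * D / (N - real M - D))) \<le> (\<Prod>i<M. 1 - D / (N - real i))"
proof -
  have "exp (- (real M * D / (N - real M - D))) = (\<Prod>i<M. exp (- (D / (N - real M - D))))"
    by (simp flip: exp_of_nat_mult)
  also have "\<dots> \<le> (\<Prod>i<M. 1 - D / (N - real i))"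
  proof (intro prod_mono conjI)
    fix i assume "i \<in> {..<M}"
    hence i: "real i \<le> real M" by simp
    have pos: "N - real M - D > 0" "N - real i > 0" "N - real i - D > 0" using i assms by linarith+
    have "D / (N - real i - D) \<le> D / (N - real M - D)"
      using i assms pos by (intro divide_left_mono) auto
    hence "exp (- (D / (N - real M - D))) \<le> exp (- (D / (N - real i - D)))" by simp
    also have "\<dots> = inverse (exp (D / (N - real i - D)))" by (simp add: exp_minus)
    also have "\<dots> \<le> inverse (1 + D / (N - real i - D))"
      using pos assms by (intro le_imp_inverse_le exp_ge_add_one_self add_pos_nonneg) auto
    also have "\<dots> = 1 - D / (N - real i)" using pos by (simp add: field_simps)
    finally show "exp (- (D / (N - real M - D))) \<le> 1 - D / (N - real i)" .
  qed simp
  finally show ?thesis .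
qed

text \<open>Here \<open>w\<close> stands for the size of the union of two sets of size
  \<open>D\<close> that share at most \<open>c\<close> elements. Factor by factor,
  \<open>1 - w / x\<close> exceeds \<open>(1 - D / x)^2\<close> by at most \<open>c / x\<close>.
  Since the square is at least 1/4, the additive error becomes a multiplicative one,
  \<open>1 + 4 * c / x\<close>, and \<open>x >= N / 2\<close> gives the exponential.\<close>

lemma prod_one_minus_le_square:
  fixes N D w c :: real
  assumes "0 \<le> D" "0 \<le> c" "2 * D - c \<le> w" "w \<le> 2 * D" "4 * D \<le> N" "2 * real M \<le> N" "0 < N"
  shows "(\<Prod>i<M. 1 - w / (N - real i))
           \<le> exp (8 * c * real M / N) * (\<Prod>i<M. 1 - D / (N - real i))\<^sup>2"
proof -
  have "(\<Prod>i<M. 1 - w / (N - real i)) \<le> (\<Prod>i<M. exp (8 * c / N) * (1 - D / (N - real i))\<^sup>2)"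
  proof (intro prod_mono conjI)
    fix i assume "i \<in> {..<M}"
    hence "real i \<le> real M" by simp
    define x where "x = N - real i"
    have x: "N \<le> 2 * x" "x > 0" "2 * D \<le> x" using assms \<open>real i \<le> real M\<close> by (auto simp: x_def)
    show "0 \<le> 1 - w / (N - real i)" unfolding x_def[symmetric] using x assms by simp
    define y where "y = D / x"
    have y: "y \<le> 1 / 2" using x by (simp add: y_def field_simps)
    have q: "(1 - y)\<^sup>2 \<ge> 1 / 4" using power_mono[of "1 / 2" "1 - y" 2] y by (simp add: power2_eq_square)
    have "1 - w / x \<le> 1 - (2 * D - c) / x" using x assms by (simp add: divide_right_mono)
    also have "\<dots> = 1 - 2 * y + c / x" by (simp add: y_def diff_divide_distrib)
    also have "\<dots> \<le> (1 - y)\<^sup>2 + c / x" by (simp add: power2_eq_square algebra_simps)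
    also have "\<dots> \<le> (1 - y)\<^sup>2 + (4 * (1 - y)\<^sup>2) * (c / x)"
      using q x assms by (intro add_left_mono) (simp add: divide_right_mono mult_le_cancel_right1)
    also have "\<dots> = (1 - y)\<^sup>2 * (1 + 4 * c / x)" by (simp add: algebra_simps)
    also have "\<dots> \<le> (1 - y)\<^sup>2 * exp (8 * c / N)"
    proof (rule mult_left_mono)
      have "4 * c / x = 8 * c / (2 * x)" by simp
      also have "\<dots> \<le> 8 * c / N" using x assms by (intro divide_left_mono) auto
      finally show "1 + 4 * c / x \<le> exp (8 * c / N)"
        using exp_ge_add_one_self[of "8 * c / N"] by linarith
    qed simp
    finally show "1 - w / (N - real i) \<le> exp (8 * c / N) * (1 - D / (N - real i))\<^sup>2"
      by (simp add: x_def y_def mult.commute)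
  qed
  also have "\<dots> = exp (8 * c * real M / N) * (\<Prod>i<M. 1 - D / (N - real i))\<^sup>2"
    by (simp add: prod.distrib prod_power_distrib mult_ac flip: exp_of_nat_mult)
  finally show ?thesis .
qed

section \<open>Connectedness through links\<close>

lemma finite_subsets_of_size: "finite V \<Longrightarrow> finite (subsets_of_size k V)"
  by (simp add: subsets_of_size_def)

lemma card_subsets_of_size: "finite V \<Longrightarrow> card (subsets_of_size k V) = card V choose k"
  by (simp add: subsets_of_size_def n_subsets)

lemma card_supersets_of_size:
  assumes "finite V" "J \<subseteq> V" "card J \<le> k"
  shows "card {E \<in> subsets_of_size k V. J \<subseteq> E} = (card V - card J) choose (k - card J)"
proof -
  have fin: "finite J" using assms finite_subset by blast
  have "bij_betw (\<lambda>T. J \<union> T) (subsets_of_size (k - card J) (V - J)) {E \<in> subsets_of_size k V. J \<subseteq> E}"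
  proof (rule bij_betw_byWitness[where f' = "\<lambda>E. E - J"])
    show "(\<lambda>T. J \<union> T) ` subsets_of_size (k - card J) (V - J) \<subseteq> {E \<in> subsets_of_size k V. J \<subseteq> E}"
    proof safe
      fix T assume T: "T \<in> subsets_of_size (k - card J) (V - J)"
      hence "finite T" "J \<inter> T = {}" using assms(1) finite_subset[of T V] by (auto simp: subsets_of_size_def)
      thus "J \<union> T \<in> subsets_of_size k V"
        using T assms fin by (auto simp: subsets_of_size_def card_Un_disjoint)
    qed
    show "(\<lambda>E. E - J) ` {E \<in> subsets_of_size k V. J \<subseteq> E} \<subseteq> subsets_of_size (k - card J) (V - J)"
      using fin by (auto simp: subsets_of_size_def card_Diff_subset)
  qed (auto simp: subsets_of_size_def)
  hence "card {E \<in> subsets_of_size k V. J \<subseteq> E} = card (subsets_of_size (k - card J) (V - J))"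
    by (simp add: bij_betw_same_card)
  also have "\<dots> = (card V - card J) choose (k - card J)"
    using assms fin by (simp add: card_subsets_of_size card_Diff_subset)
  finally show ?thesis .
qed

text \<open>Only the edges through \<open>I\<close> with exactly one vertex in \<open>S\<close> are collected, since these can be
  counted exactly and already give the asymptotically correct number for small \<open>S\<close>.\<close>

definition crossing :: "nat \<Rightarrow> 'a set \<Rightarrow> 'a set \<Rightarrow> 'a set \<Rightarrow> 'a set set" where
  "crossing r V I S = (\<lambda>(u, T). insert u (I \<union> T)) ` (S \<times> subsets_of_size (r - 1) (V - I - S))"

lemma card_crossing:
  assumes "finite V" "I \<subseteq> V" "S \<subseteq> V - I"
  shows "card (crossing r V I S) = card S * ((card V - card I - card S) choose (r - 1))"
proof -
  \<comment> \<open>Both components can be read off from the edge: \<open>u\<close> is its only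
    vertex in \<open>S\<close>, and \<open>T\<close> is what lies outside \<open>I\<close> and
    \<open>S\<close>.\<close>
  have "inj_on (\<lambda>(u, T). insert u (I \<union> T)) (S \<times> subsets_of_size (r - 1) (V - I - S))"
  proof (rule inj_onI, clarify)
    fix u T u' T'
    assume a: "u \<in> S" "u' \<in> S" "T \<in> subsets_of_size (r - 1) (V - I - S)"
      "T' \<in> subsets_of_size (r - 1) (V - I - S)" and eq: "insert u (I \<union> T) = insert u' (I \<union> T')"
    have "insert u (I \<union> T) \<inter> S = {u}" "insert u' (I \<union> T') \<inter> S = {u'}"
      using a assms(3) by (auto simp: subsets_of_size_def)
    moreover have "insert u (I \<union> T) - I - S = T" "insert u' (I \<union> T') - I - S = T'"
      using a assms(3) by (auto simp: subsets_of_size_def)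
    ultimately show "u = u' \<and> T = T'" using eq by (metis singleton_inject)
  qed
  hence "card (crossing r V I S) = card S * card (subsets_of_size (r - 1) (V - I - S))"
    by (simp add: crossing_def card_image card_cartesian_product)
  moreover have "card (V - I - S) = card V - card I - card S"
    using assms finite_subset[OF assms(2,1)] finite_subset[OF assms(3)]
    by (simp add: card_Diff_subset)
  ultimately show ?thesis using assms(1) by (simp add: card_subsets_of_size)
qed

lemma crossing_subset:
  assumes "finite V" "I \<subseteq> V" "S \<subseteq> V - I" "r \<ge> 1"
  shows "crossing r V I S \<subseteq> subsets_of_size (card I + r) V"
proof
  fix E assume "E \<in> crossing r V I S"
  then obtain u T where E: "E = insert u (I \<union> T)" "u \<in> S" "T \<subseteq> V - I - S" "card T = r - 1"
    by (auto simp: crossing_def subsets_of_size_def)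
  have "finite I" "finite T" "I \<inter> T = {}" "u \<notin> I \<union> T"
    using E assms finite_subset[of I V] finite_subset[of T V] by auto
  thus "E \<in> subsets_of_size (card I + r) V"
    using E assms by (auto simp: subsets_of_size_def card_Un_disjoint)
qed

lemma crossing_not_within:
  assumes "E \<in> crossing r V I S" "S \<subseteq> V - I" "r \<ge> 2"
  shows "I \<subseteq> E" "(E - I) \<inter> S \<noteq> {}" "\<not> E - I \<subseteq> S"
proof -
  obtain u T where E: "E = insert u (I \<union> T)" "u \<in> S" "T \<subseteq> V - I - S" "card T = r - 1"
    using assms(1) by (auto simp: crossing_def subsets_of_size_def)
  have "T \<noteq> {}" using E assms(3) by auto
  thus "I \<subseteq> E" "(E - I) \<inter> S \<noteq> {}" "\<not> E - I \<subseteq> S" using E assms(2) by auto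
qed

section \<open>Walks of edges and passage between links and \<open>j\<close>-sets\<close>

lemma j_connected_pair_single:
  "E \<in> H \<Longrightarrow> J \<subseteq> E \<Longrightarrow> J' \<subseteq> E \<Longrightarrow> j_connected_pair j H J J'"
  unfolding j_connected_pair_def by (intro exI[of _ "[E]"]) auto

text \<open>The two walks can be concatenated, because both edges at the seam contain
  \<open>J2\<close>. Finiteness of the edges matters, since an infinite intersection would have
  cardinality 0.\<close>

lemma j_connected_pair_trans:
  assumes "j_connected_pair j H J1 J2" "j_connected_pair j H J2 J3"
    and fin: "\<And>E. E \<in> H \<Longrightarrow> finite E" and "j \<le> card J2"
  shows "j_connected_pair j H J1 J3"
proof -
  obtain Es where Es: "Es \<noteq> []" "set Es \<subseteq> H" "J1 \<subseteq> hd Es" "J2 \<subseteq> last Es"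
    "\<And>i. Suc i < length Es \<Longrightarrow> j \<le> card (Es ! i \<inter> Es ! Suc i)"
    using assms(1) by (auto simp: j_connected_pair_def)
  obtain Fs where Fs: "Fs \<noteq> []" "set Fs \<subseteq> H" "J2 \<subseteq> hd Fs" "J3 \<subseteq> last Fs"
    "\<And>i. Suc i < length Fs \<Longrightarrow> j \<le> card (Fs ! i \<inter> Fs ! Suc i)"
    using assms(2) by (auto simp: j_connected_pair_def)
  have mid: "j \<le> card (last Es \<inter> hd Fs)"
  proof -
    have "finite (last Es)" using Es(1,2) last_in_set fin by blast
    hence "card J2 \<le> card (last Es \<inter> hd Fs)" using Es Fs by (intro card_mono) auto
    thus ?thesis using assms(4) by simp
  qed
  show ?thesis unfolding j_connected_pair_def
  proof (intro exI[of _ "Es @ Fs"] conjI allI impI)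
    fix i assume i: "Suc i < length (Es @ Fs)"
    consider "Suc i < length Es" | "Suc i = length Es" | "length Es \<le> i" by linarith
    thus "j \<le> card ((Es @ Fs) ! i \<inter> (Es @ Fs) ! Suc i)"
    proof cases
      case 1 thus ?thesis using Es(5)[of i] by (simp add: nth_append)
    next
      case 2
      hence "(Es @ Fs) ! i = last Es" "(Es @ Fs) ! Suc i = hd Fs"
        using Es Fs by (auto simp: nth_append last_conv_nth hd_conv_nth simp flip: 2)
      thus ?thesis using mid by simp
    next
      case 3 thus ?thesis using Fs(5)[of "i - length Es"] i
        by (simp add: nth_append Suc_diff_le)
    qed
  qed (use Es Fs in auto)
qed

lemma j_connected_if_links_connected:
  assumes "finite V" "j \<ge> 1" "H \<subseteq> Pow V"
    and link: "\<And>I S. I \<subseteq> V \<Longrightarrow> card I = j - 1 \<Longrightarrow> S \<subseteq> V - I \<Longrightarrow> S \<noteq> {} \<Longrightarrow> S \<noteq> V - I \<Longrightarrow>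
                 \<exists>E\<in>H. I \<subseteq> E \<and> (E - I) \<inter> S \<noteq> {} \<and> \<not> E - I \<subseteq> S"
    and "card V > j"
  shows "j_connected j V H"
proof -
  have finE: "finite E" if "E \<in> H" for E using that assms(1,3) finite_subset by blast
  have exch: "j_connected_pair j H (insert v I) (insert w I)"
    if I: "I \<subseteq> V" "card I = j - 1" and v: "v \<in> V - I" and w: "w \<in> V - I" for I v w
  proof -
    have finI: "finite I" using I assms(1) finite_subset by blast
    have ins: "card (insert u I) = j" if "u \<in> V - I" for u
      using that I finI assms(2) by simp
    \<comment> \<open>The vertices of the link that can replace \<open>v\<close>. If some vertex
      were missing, an edge of the link would leave \<open>S\<close>, and it would join a vertex of
      \<open>S\<close> to one outside.\<close>
    define S where "S = {u \<in> V - I. j_connected_pair j H (insert v I) (insert u I)}"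
    have two: "card (V - I) \<ge> 2" using I finI assms by (simp add: card_Diff_subset)
    \<comment> \<open>The relation is not reflexive by itself: \<open>v\<close> belongs to
      \<open>S\<close> only because some edge contains \<open>insert v I\<close>. The edge leaving
      the singleton is such an edge, and \<open>card V > j\<close> makes the singleton a proper
      subset.\<close>
    hence "{v} \<noteq> V - I" by (metis card_1_singleton_iff One_nat_def not_less_eq_eq numeral_2_eq_2 order_refl)
    then obtain E where E: "E \<in> H" "I \<subseteq> E" "(E - I) \<inter> {v} \<noteq> {}" using link[OF I, of "{v}"] v by auto
    hence "v \<in> S" using v by (auto simp: S_def intro!: j_connected_pair_single[of E])
    have "S = V - I"
    proof (rule ccontr)
      assume ne: "S \<noteq> V - I"
      have "\<exists>E\<in>H. I \<subseteq> E \<and> (E - I) \<inter> S \<noteq> {} \<and> \<not> E - I \<subseteq> S"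
        by (rule link[OF I]) (use \<open>v \<in> S\<close> ne in \<open>auto simp: S_def\<close>)
      then obtain E x y where E: "E \<in> H" "I \<subseteq> E" "x \<in> E" "x \<in> S" "y \<in> E - I" "y \<notin> S" by auto
      have y: "y \<in> V - I" using E assms(3) by auto
      have x: "x \<in> V - I" "j_connected_pair j H (insert v I) (insert x I)" using E by (auto simp: S_def)
      have "j_connected_pair j H (insert x I) (insert y I)"
        using E by (auto intro!: j_connected_pair_single[of E])
      hence "j_connected_pair j H (insert v I) (insert y I)"
        by (rule j_connected_pair_trans[OF x(2)]) (use finE ins[OF x(1)] in auto)
      thus False using E y by (auto simp: S_def)
    qed
    thus ?thesis using w by (auto simp: S_def)
  qed
  have pair: "j_connected_pair j H J J'"
    if "J \<in> subsets_of_size j V" "J' \<in> subsets_of_size j V" for J J'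
    using that
  proof (induction "card (J' - J)" arbitrary: J rule: less_induct)
    case less
    have J: "J \<subseteq> V" "card J = j" "J' \<subseteq> V" "card J' = j" using less.prems by (auto simp: subsets_of_size_def)
    have fin: "finite J" "finite J'" using J assms(1) finite_subset by blast+
    show ?case
    proof (cases "J = J'")
      case True
      \<comment> \<open>The induction ends at equal sets, where an edge containing the set is still
        required. Exchanging a vertex for itself provides it.\<close>
      obtain v where v: "v \<in> J" using J assms(2) by fastforce
      have "j_connected_pair j H (insert v (J - {v})) (insert v (J - {v}))"
        by (rule exch) (use J v fin in auto)
      thus ?thesis using True v by (simp add: insert_absorb)
    next
      case False
      have "\<not> J' \<subseteq> J" "\<not> J \<subseteq> J'" using False J fin by (metis card_subset_eq)+
      then obtain x y where x: "x \<in> J'" "x \<notin> J" and y: "y \<in> J" "y \<notin> J'" by blast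
      let ?K = "insert x (J - {y})"
      have K: "card ?K = j" "?K \<subseteq> V" using J x y fin assms(2) by auto
      have "j_connected_pair j H (insert y (J - {y})) ?K"
        by (rule exch) (use J x y fin in auto)
      moreover have "insert y (J - {y}) = J" using y by auto
      moreover have "j_connected_pair j H ?K J'"
      proof (rule less.hyps)
        have "J' - ?K \<subset> J' - J" using x y by auto
        thus "card (J' - ?K) < card (J' - J)" using fin by (intro psubset_card_mono) auto
      qed (use K less.prems in \<open>auto simp: subsets_of_size_def\<close>)
      ultimately show ?thesis using j_connected_pair_trans[of j H J ?K J'] finE K by simp
    qed
  qed
  have "j_component j V H (subsets_of_size j V)"
    unfolding j_component_def pairwise_def using pair by auto
  thus ?thesis unfolding j_connected_def by blast
qed

text \<open>An isolated set alone would satisfy the definition of a component, so a second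
  \<open>j\<close>-set is needed: with \<open>j < card V\<close> one vertex can be exchanged. The
  walk to the new set starts with an edge containing \<open>J\<close>.\<close>

lemma j_connected_imp_no_isolated:
  assumes "j_connected j V H" "finite V" "1 \<le> j" "j < card V"
  shows "no_isolated j V H"
  unfolding no_isolated_def
proof
  assume "\<exists>J\<in>subsets_of_size j V. isolated H J"
  then obtain J where J: "J \<in> subsets_of_size j V" "isolated H J" by blast
  obtain C where C: "j_component j V H C" "subsets_of_size j V \<subseteq> C"
    using assms(1) by (auto simp: j_connected_def)
  have JV: "J \<subseteq> V" "card J = j" using J by (auto simp: subsets_of_size_def)
  obtain y where y: "y \<in> J" using JV assms(3) by fastforce
  obtain x where x: "x \<in> V" "x \<notin> J" using JV assms(4) by (metis nat_less_le subsetI subset_antisym)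
  have "finite J" using JV assms(2) finite_subset by blast
  hence "insert x (J - {y}) \<in> subsets_of_size j V"
    using x y JV assms(3) by (auto simp: subsets_of_size_def)
  moreover have "insert x (J - {y}) \<noteq> J" using x by auto
  ultimately have "j_connected_pair j H J (insert x (J - {y}))"
    using C J unfolding j_component_def pairwise_def by (metis subsetD)
  then obtain Es where "Es \<noteq> []" "set Es \<subseteq> H" "J \<subseteq> hd Es" by (auto simp: j_connected_pair_def)
  thus False using J(2) hd_in_set unfolding isolated_def by blast
qed

lemma no_isolated_mono:
  "no_isolated j V H \<Longrightarrow> H \<subseteq> H' \<Longrightarrow> no_isolated j V H'"
  unfolding no_isolated_def isolated_def by blast

text \<open>A set \<open>S\<close> that disconnects the link of \<open>I\<close> at time \<open>\<tau>\<^sub>i\<close> is already closed at the earlier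
  time \<open>M0\<close>, and since no vertex of the link is isolated at time \<open>\<tau>\<^sub>i \<le> M1\<close>, it contains an edge
  of the link at time \<open>M1\<close>.\<close>

lemma tau_c_eq_tau_i:
  fixes n j k M0 M1 :: nat and es :: "nat set list"
  defines "V \<equiv> {1..n}" and "r \<equiv> k - j + 1"
  assumes "1 \<le> j" "j < k" "k \<le> n" "set es \<subseteq> subsets_of_size k V"
    and early: "\<not> no_isolated j V (hypergraph_at es M0)"
    and late: "no_isolated j V (hypergraph_at es M1)"
    and mid: "\<And>I S. I \<in> subsets_of_size (j - 1) V \<Longrightarrow> S \<subseteq> V - I \<Longrightarrow> 2 \<le> card S \<Longrightarrow>
        2 * card S \<le> n + 1 - j \<Longrightarrow> hypergraph_at es M0 \<inter> crossing r V I S = {} \<Longrightarrow>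
        \<not> (\<exists>E\<in>hypergraph_at es M1. I \<subseteq> E \<and> E - I \<subseteq> S)"
  shows "tau_c n j es = tau_i n j es"
proof -
  define \<tau> where "\<tau> = tau_i n j es"
  let ?H = "hypergraph_at es"
  have mono: "?H M \<subseteq> ?H M'" if "M \<le> M'" for M M'
    unfolding hypergraph_at_def using that by (rule set_take_subset_set_take)
  have ni: "no_isolated j V (?H \<tau>)"
    unfolding \<tau>_def tau_i_def V_def using LeastI[of "\<lambda>M. no_isolated j {1..n} (?H M)"] late V_def by blast
  have \<tau>1: "\<tau> \<le> M1"
    unfolding \<tau>_def tau_i_def using late by (auto simp: V_def intro: Least_le)
  have \<tau>0: "M0 \<le> \<tau>"
    using early no_isolated_mono[OF ni mono] by (meson nat_le_linear)
  have edge: "E \<subseteq> V" "card E = k" if "E \<in> ?H M" for E M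
    using that assms(6) set_take_subset[of M es] by (auto simp: hypergraph_at_def subsets_of_size_def)
  have finV: "finite V" by (simp add: V_def)
  have small: False
    if I: "I \<subseteq> V" "card I = j - 1" and S: "S \<subseteq> V - I" "S \<noteq> {}" "2 * card S \<le> n + 1 - j"
      and cl: "\<And>E. E \<in> ?H \<tau> \<Longrightarrow> I \<subseteq> E \<Longrightarrow> (E - I) \<inter> S \<noteq> {} \<Longrightarrow> E - I \<subseteq> S" for I S
  proof -
    have fin: "finite I" "finite S" using I S finV finite_subset by blast+
    obtain v where v: "v \<in> S" using S by auto
    have "insert v I \<in> subsets_of_size j V" using I S v fin assms(3) by (auto simp: subsets_of_size_def)
    then obtain E where E: "E \<in> ?H \<tau>" "insert v I \<subseteq> E"
      using ni by (auto simp: no_isolated_def isolated_def)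
    have ES: "E - I \<subseteq> S" using cl[of E] E v S by auto
    \<comment> \<open>The link edge found lies inside \<open>S\<close> and has \<open>r >= 2\<close>
      vertices, which rules out singletons.\<close>
    have "card (E - I) = r"
      using E edge(2)[OF E(1)] I fin assms(3,4) by (simp add: card_Diff_subset r_def)
    hence "2 \<le> card S" using card_mono[OF fin(2) ES] assms(4) by (simp add: r_def)
    moreover have "?H M0 \<inter> crossing r V I S = {}"
    proof (rule ccontr)
      assume "?H M0 \<inter> crossing r V I S \<noteq> {}"
      then obtain F where "F \<in> ?H M0" "F \<in> crossing r V I S" by auto
      moreover have "r \<ge> 2" using assms(4) by (simp add: r_def)
      ultimately show False using crossing_not_within[of F r V I S] S(1) cl[of F] mono[OF \<tau>0] by blast
    qed
    ultimately show False using mid[of I S] I S E ES mono[OF \<tau>1] by (auto simp: subsets_of_size_def)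
  qed
  have "j_connected j V (?H \<tau>)"
  proof (rule j_connected_if_links_connected[OF finV assms(3)])
    fix I S assume I: "I \<subseteq> V" "card I = j - 1" and S: "S \<subseteq> V - I" "S \<noteq> {}" "S \<noteq> V - I"
    show "\<exists>E\<in>?H \<tau>. I \<subseteq> E \<and> (E - I) \<inter> S \<noteq> {} \<and> \<not> E - I \<subseteq> S"
    proof (rule ccontr)
      assume no: "\<not> ?thesis"
      have fin: "finite I" using I finV finite_subset by blast
      have m: "card (V - I) = n + 1 - j" using I fin assms(3) by (simp add: card_Diff_subset V_def)
      \<comment> \<open>That no link edge runs between \<open>S\<close> and its complement is
        symmetric in the two, so the smaller side can be used; it has at most half of the
        \<open>n + 1 - j\<close> vertices of the link.\<close>
      have "card (V - I - S) + card S = card (V - I)"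
        using S finV by (metis card_Diff_subset card_mono finite_Diff finite_subset le_add_diff_inverse2)
      then consider "2 * card S \<le> n + 1 - j" | "2 * card (V - I - S) \<le> n + 1 - j"
        using m by linarith
      thus False
      proof cases
        case 1
        show False by (rule small[OF I S(1,2) 1]) (use no in blast)
      next
        case 2
        show False
        proof (rule small[OF I _ _ 2])
          fix E assume E: "E \<in> ?H \<tau>" "I \<subseteq> E" "(E - I) \<inter> (V - I - S) \<noteq> {}"
          hence "(E - I) \<inter> S = {}" using no by blast
          thus "E - I \<subseteq> V - I - S" using edge(1)[OF E(1)] by blast
        qed (use S in auto)
      qed
    qed
  qed (use edge assms in \<open>auto simp: V_def\<close>)
  \<comment> \<open>The opposite inequality between the hitting times: connectedness already
    excludes isolated sets.\<close>
  moreover have "\<tau> \<le> M" if "j_connected j V (?H M)" for M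
  proof -
    have "no_isolated j V (?H M)"
      using that by (rule j_connected_imp_no_isolated) (use assms in \<open>auto simp: V_def\<close>)
    thus ?thesis unfolding \<tau>_def tau_i_def V_def by (rule Least_le)
  qed
  ultimately have "tau_c n j es = \<tau>"
    unfolding tau_c_def V_def by (intro Least_equality) auto
  thus ?thesis by (simp add: \<tau>_def)
qed

section \<open>Probability bounds for the hypergraph process\<close>

text \<open>First moment: a \<open>j\<close>-set is isolated exactly when none of the
  \<open>k\<close>-sets containing it has been drawn, and a union bound runs over all
  \<open>j\<close>-sets.\<close>

lemma prob_isolated_le:
  assumes "j \<le> k" "k \<le> n" "M \<le> n choose k"
  shows "measure_pmf.prob (hypergraph_process k n) {es. \<not> no_isolated j {1..n} (hypergraph_at es M)}
           \<le> real (n choose j) * exp (- (real ((n - j) choose (k - j)) * real M / real (n choose k)))"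
proof -
  let ?V = "{1..n}" and ?J = "subsets_of_size j {1..n}"
  let ?U = "subsets_of_size k ?V"
  define A where "A J = {E \<in> ?U. J \<subseteq> E}" for J
  have U: "finite ?U" "card ?U = n choose k" by (simp_all add: finite_subsets_of_size card_subsets_of_size)
  have "measure_pmf.prob (hypergraph_process k n) {es. \<not> no_isolated j ?V (hypergraph_at es M)}
      \<le> measure_pmf.prob (draws ?U (n choose k)) (\<Union>J\<in>?J. {es. set (take M es) \<inter> A J = {}})"
    unfolding hypergraph_process_def hypergraph_steps_eq_draws
    by (intro measure_pmf.finite_measure_mono)
       (auto simp: no_isolated_def isolated_def hypergraph_at_def A_def)
  also have "\<dots> \<le> (\<Sum>J\<in>?J. measure_pmf.prob (draws ?U (n choose k)) {es. set (take M es) \<inter> A J = {}})"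
    by (intro measure_pmf.finite_measure_subadditive_finite) (auto simp: finite_subsets_of_size)
  also have "\<dots> \<le> (\<Sum>J\<in>?J. exp (- (real ((n - j) choose (k - j)) * real M / real (n choose k))))"
  proof (rule sum_mono)
    fix J assume "J \<in> ?J"
    hence J: "J \<subseteq> ?V" "card J = j" by (auto simp: subsets_of_size_def)
    have "card (A J) = (n - j) choose (k - j)"
      unfolding A_def using card_supersets_of_size[of ?V J k] J assms(1) by simp
    moreover have "measure_pmf.prob (draws ?U (n choose k)) {es. set (take M es) \<inter> A J = {}}
        = measure_pmf.prob (draws ?U M) {es. set es \<inter> A J = {}}"
      using U assms by (intro prob_take_draws) auto
    ultimately show "measure_pmf.prob (draws ?U (n choose k)) {es. set (take M es) \<inter> A J = {}}
        \<le> exp (- (real ((n - j) choose (k - j)) * real M / real (n choose k)))"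
      using prob_draws_avoid_le[OF U(1), of M "A J"] U assms by (auto simp: A_def)
  qed
  also have "\<dots> = real (n choose j) * exp (- (real ((n - j) choose (k - j)) * real M / real (n choose k)))"
    by (simp add: card_subsets_of_size)
  finally show ?thesis .
qed

text \<open>The second moment method for the events that a \<open>j\<close>-set is isolated. The
  first summand is the reciprocal of a lower bound for their expected number, the second measures
  the correlation of two of them.\<close>

lemma prob_no_isolated_le:
  fixes n j k M :: nat
  defines "D \<equiv> real ((n - j) choose (k - j))" and "N \<equiv> real (n choose k)"
    and "c \<equiv> real ((n - j - 1) choose (k - j - 1))"
  assumes "j < k" "k \<le> n" "4 * D \<le> N" "2 * real M \<le> N" "real M + D < N"
  shows "measure_pmf.prob (hypergraph_process k n) {es. no_isolated j {1..n} (hypergraph_at es M)}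
           \<le> exp (real M * D / (N - real M - D)) / real (n choose j) + (exp (8 * c * real M / N) - 1)"
proof -
  let ?V = "{1..n}" and ?J = "subsets_of_size j {1..n}"
  let ?U = "subsets_of_size k ?V"
  define A where "A J = {E \<in> ?U. J \<subseteq> E}" for J
  define a where "a = (\<Prod>i<M. 1 - D / (N - real i))"
  have U: "finite ?U" "card ?U = n choose k" by (simp_all add: finite_subsets_of_size card_subsets_of_size)
  have nn: "D \<ge> 0" "c \<ge> 0" "N > 0" using assms(4,5) by (auto simp: D_def c_def N_def)
  have MN: "M \<le> card ?U" using assms(8) nn(1) unfolding U N_def by linarith
  have a: "exp (- (real M * D / (N - real M - D))) \<le> a"
    unfolding a_def using nn assms by (intro prod_one_minus_ge_exp) auto
  have apos: "a > 0" by (rule less_le_trans[OF exp_gt_zero a])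
  have cardA: "real (card (A J)) = D" if "J \<in> ?J" for J
    unfolding A_def D_def using card_supersets_of_size[of ?V J k] that assms(4)
    by (simp add: subsets_of_size_def)
  have "measure_pmf.prob (hypergraph_process k n) {es. no_isolated j ?V (hypergraph_at es M)}
      \<le> measure_pmf.prob (draws ?U (n choose k)) {es. \<forall>J\<in>?J. set (take M es) \<inter> A J \<noteq> {}}"
    unfolding hypergraph_process_def hypergraph_steps_eq_draws
  proof (intro measure_pmf.finite_measure_mono_AE AE_pmfI impI)
    fix es assume es: "es \<in> set_pmf (draws ?U (n choose k))"
      and ni: "es \<in> {es. no_isolated j ?V (hypergraph_at es M)}"
    have "set es \<subseteq> ?U" using set_pmf_draws[OF U(1) _ es] U by simp
    hence "set (take M es) \<subseteq> ?U" using set_take_subset[of M es] by blast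
    thus "es \<in> {es. \<forall>J\<in>?J. set (take M es) \<inter> A J \<noteq> {}}"
      using ni by (fastforce simp: no_isolated_def isolated_def hypergraph_at_def A_def)
  qed auto
  also have "\<dots> = measure_pmf.prob (draws ?U M) {es. \<forall>J\<in>?J. set es \<inter> A J \<noteq> {}}"
    using U MN by (intro prob_take_draws) auto
  also have "\<dots> = measure_pmf.prob (draws ?U M) {es. \<forall>J\<in>?J. es \<notin> {es. set es \<inter> A J = {}}}"
    by simp
  also have "\<dots> \<le> 1 / (real (card ?J) * a) + (exp (8 * c * real M / N) - 1)"
  proof (rule second_moment)
    show "finite ?J" by (simp add: finite_subsets_of_size)
    have "card ?J > 0" using assms(4,5) by (simp add: card_subsets_of_size)
    thus "?J \<noteq> {}" by force
    fix J assume J: "J \<in> ?J"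
    show "measure_pmf.prob (draws ?U M) {es. set es \<inter> A J = {}} = a"
      unfolding a_def using prob_draws_avoid[OF U(1) MN, of "A J"] cardA[OF J] U
      by (simp add: A_def N_def)
    fix J' assume J': "J' \<in> ?J" and ne: "J \<noteq> J'"
    have JJ: "J \<subseteq> ?V" "J' \<subseteq> ?V" "card J = j" "card J' = j" "finite J"
      using J J' finite_subset[of J ?V] by (auto simp: subsets_of_size_def)
    have fin: "finite (A J)" "finite (A J')" using U(1) by (auto simp: A_def)
    have "\<not> J' \<subseteq> J" using ne JJ by (metis card_subset_eq)
    then obtain x where x: "x \<in> J'" "x \<notin> J" by blast
    \<comment> \<open>A \<open>k\<close>-set containing both \<open>J\<close> and \<open>J'\<close>
      contains \<open>J\<close> and one further vertex, so the two families overlap in at most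
      \<open>c\<close> sets.\<close>
    have "card (A J \<inter> A J') \<le> card {E \<in> ?U. insert x J \<subseteq> E}"
      using U(1) x by (intro card_mono) (auto simp: A_def)
    also have "\<dots> = (n - j - 1) choose (k - j - 1)"
      using card_supersets_of_size[of ?V "insert x J" k] JJ x assms(4) by auto
    finally have i: "real (card (A J \<inter> A J')) \<le> c" by (simp add: c_def)
    have u: "real (card (A J \<union> A J')) + real (card (A J \<inter> A J')) = 2 * D"
      using card_Un_Int[OF fin] cardA[OF J] cardA[OF J'] by (simp flip: of_nat_add)
    have "measure_pmf.prob (draws ?U M) ({es. set es \<inter> A J = {}} \<inter> {es. set es \<inter> A J' = {}})
        = measure_pmf.prob (draws ?U M) {es. set es \<inter> (A J \<union> A J') = {}}"
      by (rule arg_cong[where f = "measure_pmf.prob _"]) auto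
    also have "\<dots> = (\<Prod>i<M. 1 - real (card (A J \<union> A J')) / (N - real i))"
      using prob_draws_avoid[OF U(1) MN, of "A J \<union> A J'"] U by (simp add: A_def N_def)
    also have "\<dots> \<le> exp (8 * c * real M / N) * a\<^sup>2"
      unfolding a_def using nn i u assms by (intro prod_one_minus_le_square) auto
    finally show "measure_pmf.prob (draws ?U M) ({es. set es \<inter> A J = {}} \<inter> {es. set es \<inter> A J' = {}})
        \<le> exp (8 * c * real M / N) * a\<^sup>2" .
  qed (use apos in auto)
  also have "1 / (real (card ?J) * a) \<le> exp (real M * D / (N - real M - D)) / real (n choose j)"
  proof -
    have "1 / a \<le> 1 / exp (- (real M * D / (N - real M - D)))"
      using a apos by (intro divide_left_mono) auto
    hence "1 / a \<le> exp (real M * D / (N - real M - D))" by (simp add: exp_minus field_simps)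
    hence "1 / a / real (n choose j) \<le> exp (real M * D / (N - real M - D)) / real (n choose j)"
      by (rule divide_right_mono) simp
    thus ?thesis by (simp add: card_subsets_of_size mult.commute)
  qed
  finally show ?thesis by simp
qed

text \<open>The bad event for the pair \<open>I\<close>, \<open>S\<close>, where
  \<open>k - j + 1\<close> is the uniformity of the link. It refers to two fixed times instead of
  the random hitting time, so that its probability can be computed.\<close>

definition closed_with_edge :: "nat \<Rightarrow> nat \<Rightarrow> nat \<Rightarrow> nat set \<Rightarrow> nat \<Rightarrow> nat \<Rightarrow> nat set \<Rightarrow> nat set list set" where
  "closed_with_edge j k n I M0 M1 S =
     {es. set (take M0 es) \<inter> crossing (k - j + 1) {1..n} I S = {} \<and>
          (\<exists>E\<in>set (take M1 es). I \<subseteq> E \<and> E - I \<subseteq> S)}"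

text \<open>\<open>w\<close> is the number of crossing edges. The first bound forgets the edge
  inside \<open>S\<close>. The second is a union bound over the \<open>card S choose r\<close>
  possible such edges; none of them is a crossing edge, so avoiding and hitting can be combined. The
  factor 2 comes from \<open>N - M1 - w >= N / 2\<close>.\<close>

lemma prob_closed_with_edge_le:
  fixes n j k M0 M1 :: nat and I S :: "nat set"
  defines "N \<equiv> real (n choose k)" and "r \<equiv> k - j + 1"
    and "w \<equiv> card S * ((n + 1 - j - card S) choose (k - j))"
  assumes "1 \<le> j" "j < k" "k \<le> n" "M0 \<le> M1" "M1 \<le> n choose k"
    and I: "I \<in> subsets_of_size (j - 1) {1..n}" and S: "S \<subseteq> {1..n} - I"
  shows "measure_pmf.prob (hypergraph_process k n) (closed_with_edge j k n I M0 M1 S)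
            \<le> exp (- (real w * real M0 / N))" (is "?P \<le> ?e")
    and "4 * real M1 \<le> N \<Longrightarrow> 4 * real w \<le> N \<Longrightarrow>
         measure_pmf.prob (hypergraph_process k n) (closed_with_edge j k n I M0 M1 S)
            \<le> real (card S choose r) * (exp (- (real w * real M0 / N)) * (2 * real M1 / N))"
proof -
  let ?V = "{1..n}"
  let ?U = "subsets_of_size k ?V"
  let ?A = "crossing r ?V I S"
  have U: "finite ?U" "card ?U = n choose k" by (simp_all add: finite_subsets_of_size card_subsets_of_size)
  have IV: "I \<subseteq> ?V" "card I = j - 1" using I by (auto simp: subsets_of_size_def)
  have fin: "finite I" "finite S" using IV S finite_subset[of _ ?V] by (auto intro: finite_subset)
  have A: "?A \<subseteq> ?U"
    using crossing_subset[of ?V I S r] IV S assms(4,5) by (simp add: r_def)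
  have cA: "card ?A = w"
    using card_crossing[of ?V I S r] IV S assms(4) by (simp add: r_def w_def Suc_diff_le)
  have N: "N > 0" using assms(6) by (simp add: N_def)
  have av: "measure_pmf.prob (draws ?U M0) {es. set es \<inter> ?A = {}} \<le> ?e"
    using prob_draws_avoid_le[OF U(1) _ A, of M0] assms(7,8) U cA by (simp add: N_def)
  have "?P \<le> measure_pmf.prob (draws ?U (n choose k)) {es. set (take M0 es) \<inter> ?A = {}}"
    unfolding hypergraph_process_def hypergraph_steps_eq_draws closed_with_edge_def r_def
    by (intro measure_pmf.finite_measure_mono) auto
  also have "\<dots> = measure_pmf.prob (draws ?U M0) {es. set es \<inter> ?A = {}}"
    using U assms(7,8) by (intro prob_take_draws) auto
  finally show "?P \<le> ?e" using av by simp
  assume small: "4 * real M1 \<le> N" "4 * real w \<le> N"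
  define F where "F = {E \<in> ?U. I \<subseteq> E \<and> E - I \<subseteq> S}"
  have "card F \<le> card {E \<in> subsets_of_size k (I \<union> S). I \<subseteq> E}"
    using fin by (intro card_mono) (auto simp: F_def subsets_of_size_def)
  also have "\<dots> = card S choose r"
  proof -
    have "card (I \<union> S) = card I + card S" using fin S by (intro card_Un_disjoint) auto
    thus ?thesis
      using card_supersets_of_size[of "I \<union> S" I k] fin IV assms(4,5)
      by (simp add: r_def Suc_diff_le)
  qed
  finally have cF: "card F \<le> card S choose r" .
  have "?P \<le> measure_pmf.prob (draws ?U (n choose k))
      (\<Union>E\<in>F. {es. set (take M0 (take M1 es)) \<inter> ?A = {} \<and> E \<in> set (take M1 es)})"
    unfolding hypergraph_process_def hypergraph_steps_eq_draws
  proof (intro measure_pmf.finite_measure_mono_AE AE_pmfI impI)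
    fix es assume es: "es \<in> set_pmf (draws ?U (n choose k))"
      and ni: "es \<in> closed_with_edge j k n I M0 M1 S"
    have "set es \<subseteq> ?U" using set_pmf_draws[OF U(1) _ es] U by simp
    hence "set (take M1 es) \<subseteq> ?U" using set_take_subset[of M1 es] by blast
    thus "es \<in> (\<Union>E\<in>F. {es. set (take M0 (take M1 es)) \<inter> ?A = {} \<and> E \<in> set (take M1 es)})"
      using ni assms(7) by (auto simp: closed_with_edge_def r_def F_def min_def)
  qed auto
  also have "\<dots> \<le> (\<Sum>E\<in>F. measure_pmf.prob (draws ?U (n choose k))
                   {es. set (take M0 (take M1 es)) \<inter> ?A = {} \<and> E \<in> set (take M1 es)})"
    using U(1) by (intro measure_pmf.finite_measure_subadditive_finite) (auto simp: F_def)
  also have "\<dots> \<le> (\<Sum>E\<in>F. ?e * (2 * real M1 / N))"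
  proof (rule sum_mono)
    fix E assume E: "E \<in> F"
    have "r \<ge> 2" using assms(5) by (simp add: r_def)
    hence EA: "E \<notin> ?A" using crossing_not_within(3)[of E r ?V I S] S E by (auto simp: F_def)
    have lt: "M1 + card ?A < card ?U" using small N unfolding cA U N_def by linarith
    have "measure_pmf.prob (draws ?U (n choose k)) {es. set (take M0 (take M1 es)) \<inter> ?A = {} \<and> E \<in> set (take M1 es)}
        = measure_pmf.prob (draws ?U M1) {es. set (take M0 es) \<inter> ?A = {} \<and> E \<in> set es}"
      using U assms(8) by (intro prob_take_draws) auto
    also have "\<dots> \<le> measure_pmf.prob (draws ?U M0) {es. set es \<inter> ?A = {}}
              * (real M1 / (real (card ?U) - real M1 - real (card ?A)))"
      using E EA assms(7) by (intro prob_draws_hit_avoid[OF U(1) lt A]) (auto simp: F_def)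
    also have "\<dots> \<le> ?e * (real M1 / (N / 2))"
    proof (rule mult_mono[OF av])
      have "N / 2 \<le> N - real M1 - real w" using small by linarith
      thus "real M1 / (real (card ?U) - real M1 - real (card ?A)) \<le> real M1 / (N / 2)"
        unfolding cA U N_def[symmetric] using N by (intro divide_left_mono mult_pos_pos) auto
      show "0 \<le> real M1 / (real (card ?U) - real M1 - real (card ?A))"
        using lt by (intro divide_nonneg_nonneg) auto
    qed simp
    finally show "measure_pmf.prob (draws ?U (n choose k))
        {es. set (take M0 (take M1 es)) \<inter> ?A = {} \<and> E \<in> set (take M1 es)} \<le> ?e * (2 * real M1 / N)"
      by (simp add: mult.commute)
  qed
  also have "\<dots> \<le> real (card S choose r) * (?e * (2 * real M1 / N))"
    unfolding sum_constant using cF N by (intro mult_right_mono) auto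
  finally show "?P \<le> real (card S choose r) * (?e * (2 * real M1 / N))" .
qed

text \<open>Outside the events on the right the hitting times agree for every outcome by
  \<open>tau_c_eq_tau_i\<close>. The bad events are grouped by the size of \<open>S\<close>, as
  \<open>t\<close> depends on nothing else.\<close>

lemma prob_tau_neq_le:
  fixes n j k M0 M1 :: nat and t :: "nat \<Rightarrow> real"
  defines "p \<equiv> hypergraph_process k n"
  assumes "1 \<le> j" "j < k" "k \<le> n"
    and t: "\<And>I S. I \<in> subsets_of_size (j - 1) {1..n} \<Longrightarrow> S \<subseteq> {1..n} - I \<Longrightarrow> 2 \<le> card S \<Longrightarrow>
        2 * card S \<le> n + 1 - j \<Longrightarrow> measure_pmf.prob p (closed_with_edge j k n I M0 M1 S) \<le> t (card S)"
  shows "measure_pmf.prob p {es. tau_c n j es \<noteq> tau_i n j es}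
     \<le> measure_pmf.prob p {es. no_isolated j {1..n} (hypergraph_at es M0)}
      + measure_pmf.prob p {es. \<not> no_isolated j {1..n} (hypergraph_at es M1)}
      + (\<Sum>s | 2 \<le> s \<and> 2 * s \<le> n + 1 - j.
           real (n choose (j - 1)) * real ((n + 1 - j) choose s) * t s)"
proof -
  let ?V = "{1..n}"
  let ?U = "subsets_of_size k ?V"
  let ?Is = "subsets_of_size (j - 1) ?V"
  define ss where "ss = {s. 2 \<le> s \<and> 2 * s \<le> n + 1 - j}"
  have ss: "finite ss" by (rule finite_subset[of _ "{..n}"]) (auto simp: ss_def)
  have U: "finite ?U" "card ?U = n choose k" by (simp_all add: finite_subsets_of_size card_subsets_of_size)
  \<comment> \<open>The size \<open>s\<close> is recorded alongside \<open>S\<close>, so that the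
    sum over \<open>X\<close> splits as an iterated sum over sizes.\<close>
  define X where "X = Sigma ?Is (\<lambda>I. Sigma ss (\<lambda>s. subsets_of_size s (?V - I)))"
  have X: "finite X" unfolding X_def
    by (intro finite_SigmaI ss finite_subsets_of_size) auto
  let ?B = "\<lambda>(I, s, S). closed_with_edge j k n I M0 M1 S"
  let ?E0 = "{es. no_isolated j ?V (hypergraph_at es M0)}"
  let ?E1 = "{es. \<not> no_isolated j ?V (hypergraph_at es M1)}"
  have "measure_pmf.prob p {es. tau_c n j es \<noteq> tau_i n j es}
      \<le> measure_pmf.prob p (?E0 \<union> ?E1 \<union> (\<Union>x\<in>X. ?B x))"
  proof (intro measure_pmf.finite_measure_mono_AE AE_pmfI impI)
    fix es assume es: "es \<in> set_pmf p" and ne: "es \<in> {es. tau_c n j es \<noteq> tau_i n j es}"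
    have sub: "set es \<subseteq> ?U"
      using set_pmf_draws[OF U(1), of "n choose k" es] es U
      by (simp add: p_def hypergraph_process_def hypergraph_steps_eq_draws)
    show "es \<in> ?E0 \<union> ?E1 \<union> (\<Union>x\<in>X. ?B x)"
    proof (rule ccontr)
      assume no: "es \<notin> ?E0 \<union> ?E1 \<union> (\<Union>x\<in>X. ?B x)"
      have "tau_c n j es = tau_i n j es"
      proof (rule tau_c_eq_tau_i[OF assms(2-4) sub, of M0 M1])
        fix I S
        assume I: "I \<in> ?Is" and S: "S \<subseteq> ?V - I" "2 \<le> card S" "2 * card S \<le> n + 1 - j"
          and cr: "hypergraph_at es M0 \<inter> crossing (k - j + 1) ?V I S = {}"
        have "(I, card S, S) \<in> X" using I S by (auto simp: X_def ss_def subsets_of_size_def)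
        hence "es \<notin> closed_with_edge j k n I M0 M1 S" using no by auto
        thus "\<not> (\<exists>E\<in>hypergraph_at es M1. I \<subseteq> E \<and> E - I \<subseteq> S)"
          using cr by (auto simp: closed_with_edge_def hypergraph_at_def)
      qed (use no in auto)
      thus False using ne by simp
    qed
  qed auto
  also have "\<dots> \<le> measure_pmf.prob p ?E0 + measure_pmf.prob p ?E1 + measure_pmf.prob p (\<Union>x\<in>X. ?B x)"
    by (intro order.trans[OF measure_Un_le] add_right_mono measure_Un_le) auto
  also have "measure_pmf.prob p (\<Union>x\<in>X. ?B x) \<le> (\<Sum>x\<in>X. measure_pmf.prob p (?B x))"
    by (intro measure_pmf.finite_measure_subadditive_finite X) auto
  also have "\<dots> \<le> (\<Sum>(I, s, S)\<in>X. t s)"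
    by (intro sum_mono) (auto simp: X_def ss_def subsets_of_size_def intro!: t)
  also have "\<dots> = (\<Sum>I\<in>?Is. \<Sum>(s, S)\<in>Sigma ss (\<lambda>s. subsets_of_size s (?V - I)). t s)"
    unfolding X_def using ss by (intro sum.Sigma[symmetric]) (auto simp: finite_subsets_of_size)
  also have "\<dots> = (\<Sum>I\<in>?Is. \<Sum>s\<in>ss. \<Sum>S\<in>subsets_of_size s (?V - I). t s)"
    using ss by (intro sum.cong refl sum.Sigma[symmetric]) (auto simp: finite_subsets_of_size)
  also have "\<dots> = (\<Sum>I\<in>?Is. \<Sum>s\<in>ss. real ((n + 1 - j) choose s) * t s)"
  proof (intro sum.cong refl)
    fix I s assume "I \<in> ?Is"
    hence "I \<subseteq> ?V" "card I = j - 1" by (auto simp: subsets_of_size_def)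
    hence "card (?V - I) = n + 1 - j" using assms(2) finite_subset[of I ?V] by (simp add: card_Diff_subset)
    thus "(\<Sum>S\<in>subsets_of_size s (?V - I). t s) = real ((n + 1 - j) choose s) * t s"
      by (simp add: card_subsets_of_size)
  qed
  also have "\<dots> = (\<Sum>s\<in>ss. real (n choose (j - 1)) * real ((n + 1 - j) choose s) * t s)"
    by (simp add: card_subsets_of_size sum_distrib_left mult.assoc)
  finally show ?thesis by (simp add: ss_def)
qed

section \<open>Asymptotics\<close>

lemma sum_power_over_fact_le_exp:
  fixes z :: real
  assumes "z \<ge> 0" "finite A"
  shows "(\<Sum>s\<in>A. z ^ s / fact s) \<le> exp z"
proof -
  have "(\<Sum>s\<in>A. z ^ s / fact s) \<le> (\<Sum>s. z ^ s / fact s)"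
    using assms summable_exp[of z] by (intro sum_le_suminf) (auto simp: field_simps)
  thus ?thesis by (simp add: exp_def field_simps)
qed

lemma choose_le_power_over_fact: "real (n choose s) \<le> real n ^ s / fact s"
proof -
  have "real ((n choose s) * fact s) \<le> real (n ^ s)"
    by (subst of_nat_le_iff) (rule binomial_fact_pow)
  thus ?thesis by (simp add: field_simps)
qed

text \<open>\<open>s ^ s / fact s\<close> is a single term of the series of \<open>exp s\<close>, so
  \<open>1 / fact s\<close> is at most \<open>(exp 1 / s) ^ s\<close>.\<close>

lemma choose_le_exp_power:
  assumes "s \<ge> 1"
  shows "real (n choose s) \<le> (exp 1 * real n / real s) ^ s"
proof -
  have "real s ^ s / fact s \<le> exp (real s)"
    using sum_power_over_fact_le_exp[of "real s" "{s}"] by simp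
  also have "exp (real s) = exp 1 ^ s" by (simp flip: exp_of_nat_mult)
  finally have "1 / fact s \<le> (exp 1 / real s) ^ s"
    using assms by (simp add: power_divide field_simps)
  hence "real n ^ s * (1 / fact s) \<le> real n ^ s * (exp 1 / real s) ^ s"
    by (rule mult_left_mono) simp
  also have "\<dots> = (exp 1 * real n / real s) ^ s"
    by (simp add: mult.commute flip: power_mult_distrib)
  finally show ?thesis using choose_le_power_over_fact[of n s] by simp
qed

text \<open>Pascal's rule applied \<open>t\<close> times; each lowering of the upper index loses at
  most \<open>(a - 1) choose (d - 1)\<close>.\<close>

lemma choose_le_choose_diff:
  assumes "1 \<le> d" "t \<le> a"
  shows "a choose d \<le> ((a - t) choose d) + t * ((a - 1) choose (d - 1))"
  using assms(2)
proof (induction t)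
  case (Suc t)
  obtain b where b: "a - t = Suc b" using Suc.prems by (metis Suc_diff_Suc Suc_le_lessD)
  obtain e where e: "d = Suc e" using assms(1) by (cases d) auto
  have ab: "b \<le> a - 1" "a - Suc t = b" using b by auto
  have "a choose d \<le> ((a - t) choose d) + t * ((a - 1) choose (d - 1))" using Suc by simp
  also have "(a - t) choose d = (b choose d) + (b choose e)" by (simp add: b e)
  also have "b choose e \<le> (a - 1) choose (d - 1)" using ab e by (simp add: binomial_right_mono)
  finally show ?case using ab by simp
qed simp

text \<open>A first-order estimate, useful while \<open>s * d\<close> is small against
  \<open>m\<close>. It takes \<open>t = s - 1\<close> in the preceding bound and rewrites the loss
  by absorption.\<close>

lemma choose_diff_ratio_ge:
  assumes "1 \<le> d" "1 \<le> s" "s < m" "d < m"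
  shows "1 - (real s - 1) * real d / (real m - 1)
           \<le> real ((m - s) choose d) / real ((m - 1) choose d)"
proof -
  let ?D = "real ((m - 1) choose d)"
  have D: "?D > 0" using assms by simp
  obtain e where e: "d = Suc e" using assms(1) by (cases d) auto
  have "(m - 1) choose d \<le> ((m - 1 - (s - 1)) choose d) + (s - 1) * ((m - 1 - 1) choose (d - 1))"
    using assms by (intro choose_le_choose_diff) auto
  hence "(m - 1) choose d \<le> ((m - s) choose d) + (s - 1) * ((m - 1 - 1) choose e)"
    using assms e by simp
  hence "?D \<le> real (((m - s) choose d) + (s - 1) * ((m - 1 - 1) choose e))" by (simp only: of_nat_le_iff)
  hence 1: "?D \<le> real ((m - s) choose d) + (real s - 1) * real ((m - 1 - 1) choose e)"
    using assms by (simp add: of_nat_diff)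
  have "d * ((m - 1) choose d) = (m - 1) * ((m - 1 - 1) choose e)"
    unfolding e by (rule binomial_absorption)
  hence "real d * ?D = real (m - 1) * real ((m - 1 - 1) choose e)" by (metis of_nat_mult)
  hence 2: "real ((m - 1 - 1) choose e) = real d * ?D / (real m - 1)"
    using assms by (simp add: of_nat_diff field_simps)
  have "1 - real ((m - s) choose d) / ?D = (?D - real ((m - s) choose d)) / ?D"
    using D by (simp add: field_simps)
  also have "\<dots> \<le> (real s - 1) * (real d * ?D / (real m - 1)) / ?D"
    using 1 D unfolding 2 by (intro divide_right_mono) auto
  also have "\<dots> = (real s - 1) * real d / (real m - 1)" using D by simp
  finally show ?thesis by linarith
qed

text \<open>For \<open>s\<close> up to \<open>m / 2\<close> a constant suffices: the numerator is at
  least \<open>(m / (2 * d)) ^ d\<close> and the denominator at most \<open>m ^ d\<close>.\<close>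

lemma choose_diff_ratio_ge_const:
  assumes "1 \<le> d" "2 * s \<le> m" "2 * d \<le> m" "1 \<le> s"
  shows "(1 / (2 * real d)) ^ d \<le> real ((m - s) choose d) / real ((m - 1) choose d)"
proof -
  have D: "real ((m - 1) choose d) > 0" using assms by simp
  have "(m - 1) choose d \<le> (m - 1) ^ d"
    by (rule binomial_le_pow) (use assms in auto)
  also have "\<dots> \<le> m ^ d" by (rule power_mono) auto
  finally have "real ((m - 1) choose d) \<le> real m ^ d" by (metis of_nat_le_iff of_nat_power)
  hence "(1 / (2 * real d)) ^ d * real ((m - 1) choose d) \<le> (1 / (2 * real d)) ^ d * real m ^ d"
    by (intro mult_left_mono) auto
  also have "\<dots> = (real m / 2 / real d) ^ d" by (simp flip: power_mult_distrib)
  also have "\<dots> \<le> (real (m - s) / real d) ^ d"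
    using assms by (intro power_mono divide_right_mono) (auto simp: of_nat_diff)
  also have "\<dots> \<le> real ((m - s) choose d)"
    by (rule binomial_ge_n_over_k_pow_k) (use assms in auto)
  finally show ?thesis using D by (simp add: field_simps)
qed

text \<open>For \<open>s ^ 4 <= m\<close> the defect of \<alpha> from 1 costs only a factor 2, so
  the exponential is at most \<open>2 * (y / Q) ^ s\<close>. One of the \<open>s\<close> factors
  \<open>1 / Q\<close> cancels the number \<open>Q\<close> of choices of \<open>I\<close>. The edge
  inside \<open>S\<close> contributes \<open>s ^ (d + 1) / D\<close>, which is small because
  \<open>s ^ 2 <= sqrt m\<close>.\<close>

lemma small_term_le:
  fixes Q x y L D m \<alpha> :: real and s d :: nat
  assumes Q: "1 \<le> Q" and x: "0 \<le> x" "x \<le> L" and y: "exp (- x) \<le> y / Q"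
    and \<alpha>: "1 - (real s - 1) * real d / (m - 1) \<le> \<alpha>"
    and m: "1 < m" "real s ^ 4 \<le> m" and sd: "1 \<le> s" "1 \<le> d"
    and L: "L * sqrt m * real d / (m - 1) \<le> ln 2" and sm: "sqrt m * real d / (m - 1) \<le> 1"
    and D: "((m - 1) / real d) ^ d \<le> D"
  shows "Q * (m ^ s / fact s) * (real s ^ (d + 1) * (exp (- (x * real s * \<alpha>)) * (6 * L / D)))
           \<le> (m * y) ^ s / fact s * (12 * L * (sqrt m * real d / (m - 1)))"
proof -
  have s2: "real s ^ 2 \<le> sqrt m"
    using m by (intro real_le_rsqrt) (simp flip: power_mult)
  have Dpos: "D > 0" using D m sd by (intro less_le_trans[OF _ D]) auto
  have "x * ((real s - 1) * real d / (m - 1)) * real s \<le> L * (real s ^ 2) * real d / (m - 1)"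
  proof -
    have "x * ((real s - 1) * real s) \<le> L * real s ^ 2"
      using x sd by (intro mult_mono) (auto simp: power2_eq_square)
    hence "x * ((real s - 1) * real s) * (real d / (m - 1)) \<le> L * real s ^ 2 * (real d / (m - 1))"
      using m by (intro mult_right_mono) auto
    thus ?thesis by (simp add: mult_ac)
  qed
  also have "\<dots> \<le> L * sqrt m * real d / (m - 1)"
    using s2 x m by (intro divide_right_mono mult_right_mono mult_left_mono) auto
  finally have 1: "x * ((real s - 1) * real d / (m - 1)) * real s \<le> ln 2" using L by simp
  have "x * real s * (1 - (real s - 1) * real d / (m - 1)) \<le> x * real s * \<alpha>"
    using \<alpha> x by (intro mult_left_mono) auto
  hence "- (x * real s * \<alpha>) \<le> - (real s * x) + ln 2" using 1 by (simp add: algebra_simps)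
  hence "exp (- (x * real s * \<alpha>)) \<le> exp (- (real s * x) + ln 2)" by simp
  also have "\<dots> = exp (- x) ^ s * 2" unfolding exp_add by (simp flip: exp_of_nat_mult)
  also have "\<dots> \<le> (y / Q) ^ s * 2" using y by (intro mult_right_mono power_mono) auto
  finally have e: "exp (- (x * real s * \<alpha>)) \<le> (y / Q) ^ s * 2" .
  have ypos: "y > 0" using y Q less_le_trans[OF exp_gt_zero y] by (simp add: zero_less_divide_iff)
  have "Q * (y / Q) ^ s = Q / Q ^ s * y ^ s" by (simp add: power_divide)
  also have "\<dots> \<le> 1 * y ^ s"
    using Q sd ypos self_le_power[of Q s] by (intro mult_right_mono) auto
  finally have qy: "Q * (y / Q) ^ s \<le> y ^ s" by simp
  have "real s ^ (d + 1) \<le> real s ^ (2 * d)" using sd by (intro power_increasing) auto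
  also have "\<dots> \<le> sqrt m ^ d" unfolding power_mult by (intro power_mono s2) auto
  finally have "real s ^ (d + 1) / D \<le> sqrt m ^ d / ((m - 1) / real d) ^ d"
    using D m sd by (intro frac_le) auto
  also have "\<dots> = (sqrt m * real d / (m - 1)) ^ d" by (simp flip: power_divide)
  also have "\<dots> \<le> (sqrt m * real d / (m - 1)) ^ 1"
    using sm m sd by (intro power_decreasing) auto
  finally have sD: "real s ^ (d + 1) / D \<le> sqrt m * real d / (m - 1)" by simp
  have "Q * exp (- (x * real s * \<alpha>)) \<le> Q * ((y / Q) ^ s * 2)"
    using Q e by (intro mult_left_mono) auto
  also have "\<dots> \<le> y ^ s * 2" using qy by simp
  finally have qe: "Q * exp (- (x * real s * \<alpha>)) \<le> y ^ s * 2" .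
  have "Q * (m ^ s / fact s) * (real s ^ (d + 1) * (exp (- (x * real s * \<alpha>)) * (6 * L / D)))
     = (m ^ s / fact s) * (Q * exp (- (x * real s * \<alpha>))) * (6 * L * (real s ^ (d + 1) / D))"
    by simp
  also have "\<dots> \<le> (m ^ s / fact s) * (y ^ s * 2) * (6 * L * (sqrt m * real d / (m - 1)))"
    by (rule mult_mono[OF mult_left_mono[OF qe] mult_left_mono[OF sD]])
       (use x Q m ypos Dpos in auto)
  also have "\<dots> = (m * y) ^ s / fact s * (12 * L * (sqrt m * real d / (m - 1)))"
    by (simp add: power_mult_distrib)
  finally show ?thesis .
qed

text \<open>The exponential is at most \<open>(y / Q)\<close> to the power
  \<open>\<gamma> * s\<close>; since this exponent is at least 1, the denominator absorbs the factor
  \<open>Q\<close>.\<close>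

lemma large_term_le:
  fixes Q x y \<alpha> \<gamma> :: real and s :: nat
  assumes Q: "1 \<le> Q" and x: "0 \<le> x" and y: "exp (- x) \<le> y / Q"
    and \<gamma>: "\<gamma> \<le> \<alpha>" "1 \<le> \<gamma> * real s" "0 \<le> \<gamma>"
  shows "Q * exp (- (x * real s * \<alpha>)) \<le> (y powr \<gamma>) ^ s"
proof -
  have ypos: "y > 0" using y Q less_le_trans[OF exp_gt_zero y] by (simp add: zero_less_divide_iff)
  have "exp (- (x * real s * \<alpha>)) \<le> exp (- (x * real s * \<gamma>))"
    using x \<gamma> by (simp add: mult_left_mono)
  also have "\<dots> = exp (- x) powr (\<gamma> * real s)" by (simp add: powr_def mult_ac)
  also have "\<dots> \<le> (y / Q) powr (\<gamma> * real s)" using y \<gamma> by (intro powr_mono2) auto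
  also have "\<dots> = y powr (\<gamma> * real s) / Q powr (\<gamma> * real s)"
    by (rule powr_divide)
  finally have "Q * exp (- (x * real s * \<alpha>)) \<le> Q * (y powr (\<gamma> * real s) / Q powr (\<gamma> * real s))"
    using Q by (intro mult_left_mono) auto
  also have "\<dots> = Q / Q powr (\<gamma> * real s) * y powr (\<gamma> * real s)" by simp
  also have "\<dots> \<le> 1 * y powr (\<gamma> * real s)"
    using powr_mono[of 1 "\<gamma> * real s" Q] \<gamma> Q by (intro mult_right_mono) auto
  also have "\<dots> = (y powr \<gamma>) ^ s" using ypos by (simp add: powr_powr powr_realpow[symmetric])
  finally show ?thesis .
qed

text \<open>For fixed \<open>j\<close> and \<open>k\<close> the side conditions hold for all large
  \<open>n\<close>. Here \<open>m\<close> is the number of vertices of a link, and \<open>l\<close>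
  bounds the logarithm of the number of \<open>j\<close>-sets. The error terms belong, in order, to
  the absence of isolated sets at \<open>M0\<close> (two terms), their presence at
  \<open>M1\<close>, and the bad sets of size up to and above the fourth root of
  \<open>m\<close>.\<close>

lemma prob_tau_neq_explicit:
  fixes n j k :: nat
  defines "d \<equiv> real (k - j)" and "\<kappa> \<equiv> real (k choose j)" and "m \<equiv> real n + 1 - real j"
    and "l \<equiv> real j * ln (real n)" and "\<omega> \<equiv> ln (ln (real n))"
  defines "y \<equiv> 2 * \<omega> * real j / m" and "c0 \<equiv> (1 / (2 * d)) ^ (k - j)"
  assumes jk: "1 \<le> j" "j < k" "2 * k \<le> n"
    and \<omega>: "1 \<le> \<omega>" "\<omega> \<le> m / real j" and m1: "exp 1 \<le> m / real j"
    and \<kappa>m: "8 * \<kappa> * real j \<le> m" and lm: "12 * l * d \<le> m - 1" and \<kappa>s: "4 * \<kappa> * real j * sqrt m \<le> m"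
    and ls: "l * sqrt m * d / (m - 1) \<le> ln 2" and sm: "sqrt m * d / (m - 1) \<le> 1"
    and big1: "exp 1 * m powr (3 / 4) * y powr (7 / 8) \<le> 1 / 2"
    and big2: "2 ^ (8 * (k - j)) * y powr c0 \<le> 1 / 2" and c0m: "1 \<le> c0 * m powr (1 / 4)"
  shows "measure_pmf.prob (hypergraph_process k n) {es. tau_c n j es \<noteq> tau_i n j es}
     \<le> exp (2 * l * (l * d / (m - 1) + \<kappa> * real j / m)) / \<omega> + (exp (8 * d * l / (m - 1)) - 1)
        + real j / m
        + (exp (2 * \<omega> * real j) * (12 * l * (sqrt m * d / (m - 1))) + m * 2 powr (- (m powr (1 / 4))))"
proof -
  define mm where "mm = n + 1 - j"
  define B where "B = real (n choose j)"
  define Q where "Q = real (n choose (j - 1))"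
  define D where "D = real ((n - j) choose (k - j))"
  define N where "N = real (n choose k)"
  define L where "L = ln B"
  have mm: "m = real mm" using jk by (simp add: m_def mm_def of_nat_diff)
  have mm1: "n - j = mm - 1" using jk by (simp add: mm_def)
  have d1: "1 \<le> d" "d \<ge> 0" using jk by (auto simp: d_def)
  have m2: "m > 1" "m \<ge> 2 * d" "m - 1 \<ge> d" using jk by (auto simp: m_def d_def of_nat_diff)
  \<comment> \<open>Pairs of a \<open>(j - 1)\<close>-set in a \<open>j\<close>-set, counted in two
    ways. This later turns a bound in terms of \<open>\<omega> / B\<close> into one in terms of
    \<open>y / Q\<close>.\<close>
  have BQ: "B * real j = Q * m"
  proof -
    have "Suc (j - 1) * (n choose Suc (j - 1)) = (n - (j - 1)) * (n choose (j - 1))"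
      by (simp only: binomial_absorption binomial_absorb_comp)
    hence "j * (n choose j) = mm * (n choose (j - 1))" using jk by (simp add: mm_def)
    hence "real (j * (n choose j)) = real (mm * (n choose (j - 1)))" by simp
    thus ?thesis by (simp add: B_def Q_def mm mult.commute)
  qed
  \<comment> \<open>Pairs of a \<open>j\<close>-set in a \<open>k\<close>-set, counted in two ways.
    So \<open>B / \<kappa>\<close> equals \<open>N / D\<close>, about the number of steps in which a
    given \<open>j\<close>-set receives one edge on average.\<close>
  have BD: "B * D = \<kappa> * N"
  proof -
    have "(n choose k) * (k choose j) = (n choose j) * ((n - j) choose (k - j))"
      using jk by (intro choose_mult) auto
    hence "real ((n choose k) * (k choose j)) = real ((n choose j) * ((n - j) choose (k - j)))" by simp
    thus ?thesis by (simp add: B_def D_def \<kappa>_def N_def mult.commute)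
  qed
  have "n choose (j - 1) \<ge> 1" "k choose j \<ge> 1" "(n - j) choose (k - j) \<ge> 1" "n choose k \<ge> 1"
    using jk by (auto simp: Suc_le_eq)
  hence ge1: "Q \<ge> 1" "\<kappa> \<ge> 1" "D \<ge> 1" "N \<ge> 1" by (auto simp: Q_def \<kappa>_def D_def N_def)
  have j0: "real j > 0" using jk by simp
  have Beq: "B = Q * m / real j" using BQ j0 by (simp add: field_simps)
  have Bm: "m / real j \<le> B"
    unfolding Beq using ge1 m2 j0 by (intro divide_right_mono) auto
  have B1: "B \<ge> exp 1" "B > 0" using Bm m1 less_le_trans[OF exp_gt_zero, of 1 B] by auto
  have "ln (exp 1) \<le> ln B" using B1 by (subst ln_le_cancel_iff) auto
  hence L1: "L \<ge> 1" by (simp add: L_def)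
  have Ll: "L \<le> l"
  proof -
    have "n choose j \<le> n ^ j" using jk by (intro binomial_le_pow) auto
    hence "B \<le> real n ^ j" unfolding B_def by (metis of_nat_le_iff of_nat_power)
    hence "ln B \<le> ln (real n ^ j)" using B1 jk by (subst ln_le_cancel_iff) auto
    thus ?thesis using jk by (simp add: L_def l_def ln_realpow)
  qed
  have "ln \<omega> \<le> ln B" using \<omega> Bm by (subst ln_le_cancel_iff) auto
  hence \<omega>L: "ln \<omega> \<le> L" "0 \<le> ln \<omega>" using \<omega> by (auto simp: L_def)
  have Dge: "((m - 1) / d) ^ (k - j) \<le> D"
  proof -
    have "(real (n - j) / real (k - j)) ^ (k - j) \<le> D"
      unfolding D_def using jk by (intro binomial_ge_n_over_k_pow_k) auto
    thus ?thesis using jk by (simp add: m_def d_def of_nat_diff)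
  qed
  have "(m - 1) / d \<le> ((m - 1) / d) ^ (k - j)" using m2 d1 jk by (intro self_le_power) auto
  hence Dge1: "(m - 1) / d \<le> D" using Dge by simp
  have \<kappa>B: "\<kappa> / B \<le> \<kappa> * real j / m" "\<kappa> / B \<le> 1 / 8"
  proof -
    have "\<kappa> / B \<le> \<kappa> / (m / real j)" using Bm m2 j0 ge1 B1 by (intro divide_left_mono) auto
    thus "\<kappa> / B \<le> \<kappa> * real j / m" by simp
    also have "\<dots> \<le> 1 / 8" using \<kappa>m m2 by (simp add: field_simps)
    finally show "\<kappa> / B \<le> 1 / 8" .
  qed
  have LD: "L / D \<le> l * d / (m - 1)" "L / D \<le> 1 / 12"
  proof -
    have "L / D \<le> l / ((m - 1) / d)" using Ll L1 Dge1 m2 d1 by (intro frac_le) auto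
    thus "L / D \<le> l * d / (m - 1)" by simp
    also have "\<dots> \<le> 1 / 12" using lm m2 by (simp add: field_simps)
    finally show "L / D \<le> 1 / 12" .
  qed
  have DN: "D / N = \<kappa> / B" using BD B1 ge1 by (simp add: field_simps)
  have NB: "B / \<kappa> = N / D" using BD B1 ge1 by (simp add: field_simps)
  have "D / N \<le> 1 / 8" unfolding DN by (rule \<kappa>B(2))
  hence D8: "8 * D \<le> N" using ge1 by (simp add: pos_divide_le_eq)

  \<comment> \<open>At time \<open>M0\<close> about \<open>\<omega>\<close> isolated \<open>j\<close>-sets are expected: enough for the second moment method, and
    few enough for \<open>exp (2 * \<omega> * j)\<close> to be a power of \<open>ln n\<close>.\<close>
  define M0 where "M0 = nat \<lfloor>B / \<kappa> * (L - ln \<omega>)\<rfloor>"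
  \<comment> \<open>The factor 2 leaves an expected number of isolated sets of at most
    \<open>B * exp (- 2 * L) = 1 / B\<close>.\<close>
  define M1 where "M1 = nat \<lceil>B / \<kappa> * (2 * L)\<rceil>"
  have nonneg0: "0 \<le> B / \<kappa> * (L - ln \<omega>)" using B1 ge1 \<omega>L by (intro mult_nonneg_nonneg) auto
  have M0: "B / \<kappa> * (L - ln \<omega>) - 1 \<le> real M0" "real M0 \<le> B / \<kappa> * (L - ln \<omega>)"
    unfolding M0_def using nonneg0 by linarith+
  have nonneg1: "0 \<le> B / \<kappa> * (2 * L)" using B1 ge1 L1 by (intro mult_nonneg_nonneg) auto
  have M1: "B / \<kappa> * (2 * L) \<le> real M1" "real M1 \<le> B / \<kappa> * (2 * L) + 1"
    unfolding M1_def using nonneg1 by linarith+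
  have "B / \<kappa> * (L - ln \<omega>) \<le> B / \<kappa> * (2 * L)"
    using B1 ge1 \<omega>L L1 by (intro mult_left_mono) auto
  hence M01: "M0 \<le> M1" using M0 M1 by linarith
  have M1N: "real M1 / N \<le> 3 * L / D"
  proof -
    have "real M1 \<le> N / D * (2 * L) + N / D * L"
      using M1(2) D8 ge1 L1 mult_mono[of 1 "N / D" 1 L] unfolding NB by (simp add: field_simps)
    also have "\<dots> = 3 * L / D * N" by simp
    finally show ?thesis using ge1 by (simp add: pos_divide_le_eq)
  qed
  have M1N4: "4 * real M1 \<le> N"
  proof -
    have "3 * L / D = 3 * (L / D)" by simp
    hence "real M1 / N \<le> 1 / 4" using M1N LD(2) by linarith
    thus ?thesis using ge1 by (simp add: field_simps)
  qed
  have M1card: "M1 \<le> n choose k" using M1N4 unfolding N_def by linarith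
  \<comment> \<open>The expected number of edges containing a given \<open>j\<close>-set at time
    \<open>M0\<close>; rounding \<open>M0\<close> down lowers it by at most
    \<open>\<kappa> / B\<close>.\<close>
  define x where "x = real M0 * D / N"
  have xeq: "x = real M0 * (\<kappa> / B)" by (simp add: x_def flip: DN)
  have x: "x \<le> L - ln \<omega>" "L - ln \<omega> - \<kappa> / B \<le> x"
  proof -
    have "x \<le> B / \<kappa> * (L - ln \<omega>) * (\<kappa> / B)"
      unfolding xeq using M0 B1 ge1 by (intro mult_right_mono) auto
    thus "x \<le> L - ln \<omega>" using B1 ge1 by simp
    have "(B / \<kappa> * (L - ln \<omega>) - 1) * (\<kappa> / B) \<le> x"
      unfolding xeq using M0 B1 ge1 by (intro mult_right_mono) auto
    moreover have "(B / \<kappa> * (L - ln \<omega>) - 1) * (\<kappa> / B) = L - ln \<omega> - \<kappa> / B"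
      using B1 ge1 by (simp add: field_simps)
    ultimately show "L - ln \<omega> - \<kappa> / B \<le> x" by simp
  qed
  have x0: "0 \<le> x" using ge1 by (simp add: x_def)
  have xL: "x \<le> L" "x \<le> l" using x \<omega>L Ll by auto
  have expx: "exp x / B \<le> 1 / \<omega>"
  proof -
    have "exp x \<le> exp (L - ln \<omega>)" using x by simp
    also have "\<dots> = B / \<omega>" using B1 \<omega> by (simp add: exp_diff L_def)
    finally show ?thesis using B1 by (simp add: field_simps)
  qed
  have expmx: "exp (- x) \<le> y / Q"
  proof -
    have "exp (- x) \<le> exp (\<kappa> / B - (L - ln \<omega>))" using x by simp
    also have "\<dots> = exp (\<kappa> / B) * (\<omega> / B)" using B1 \<omega> by (simp add: exp_diff L_def)
    \<comment> \<open>The factor 2 in \<open>y\<close> pays for the rounding of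
      \<open>M0\<close>.\<close>
    also have "\<dots> \<le> 2 * (\<omega> / B)"
    proof (rule mult_right_mono)
      have "exp (\<kappa> / B) \<le> exp (1 / 8)" using \<kappa>B by simp
      also have "\<dots> \<le> 2" using exp_bound[of "1 / 8"] by (simp add: power2_eq_square)
      finally show "exp (\<kappa> / B) \<le> 2" .
    qed (use \<omega> B1 in auto)
    also have "\<dots> = y / Q" unfolding Beq y_def by (simp add: mult_ac)
    finally show ?thesis .
  qed

  have T1: "measure_pmf.prob (hypergraph_process k n) {es. no_isolated j {1..n} (hypergraph_at es M0)}
      \<le> exp (2 * l * (l * d / (m - 1) + \<kappa> * real j / m)) / \<omega> + (exp (8 * d * l / (m - 1)) - 1)"
  proof -
    define c where "c = real ((n - j - 1) choose (k - j - 1))"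
    have "Suc (k - j - 1) * ((n - j) choose Suc (k - j - 1)) = (n - j) * ((n - j - 1) choose (k - j - 1))"
      by (rule binomial_absorption)
    hence "real ((k - j) * ((n - j) choose (k - j))) = real ((n - j) * ((n - j - 1) choose (k - j - 1)))"
      using jk by (simp add: Suc_diff_Suc)
    hence "d * D = (m - 1) * c" using jk by (simp add: d_def D_def c_def m_def of_nat_diff)
    hence c: "c = d * D / (m - 1)" using m2 by (simp add: field_simps)
    have lt: "real M0 + D < N" using M01 M1N4 D8 ge1 by linarith
    have "measure_pmf.prob (hypergraph_process k n) {es. no_isolated j {1..n} (hypergraph_at es M0)}
       \<le> exp (real M0 * D / (N - real M0 - D)) / B + (exp (8 * c * real M0 / N) - 1)"
      unfolding B_def D_def N_def c_def
      by (rule prob_no_isolated_le) (use jk D8 M01 M1N4 lt ge1 in \<open>auto simp: D_def N_def\<close>)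
    also have "exp (8 * c * real M0 / N) \<le> exp (8 * d * l / (m - 1))"
    proof -
      have "8 * c * real M0 / N = 8 * d * x / (m - 1)" by (simp add: c x_def mult_ac)
      also have "\<dots> \<le> 8 * d * l / (m - 1)"
        using xL d1 m2 by (intro divide_right_mono mult_left_mono) auto
      finally show ?thesis by simp
    qed
    also have "exp (real M0 * D / (N - real M0 - D)) / B
        \<le> exp (2 * l * (l * d / (m - 1) + \<kappa> * real j / m)) / \<omega>"
    proof -
      \<comment> \<open>This is \<open>(M0 + D) / N\<close>, the relative loss in the denominator;
        \<open>1 / (1 - u) <= 1 + 2 * u\<close> holds because \<open>u <= 1 / 2\<close>.\<close>
      define u where "u = x / D + \<kappa> / B"
      have "x / D \<le> L / D" using xL ge1 by (intro divide_right_mono) auto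
      hence u: "u \<le> l * d / (m - 1) + \<kappa> * real j / m" "u \<le> 1 / 2"
        unfolding u_def using LD \<kappa>B by linarith+
      have u0: "0 \<le> u" using x0 ge1 B1 by (simp add: u_def)
      have "N - real M0 - D = N * (1 - u)"
        using ge1 unfolding u_def DN[symmetric] x_def by (simp add: field_simps)
      hence "real M0 * D / (N - real M0 - D) = x / (1 - u)" by (simp add: x_def)
      also have "\<dots> \<le> x * (1 + 2 * u)"
      proof -
        have "1 \<le> (1 + 2 * u) * (1 - u)"
          using u u0 mult_left_mono[of "2 * u" 1 u] by (simp add: algebra_simps)
        hence "x * 1 \<le> x * ((1 + 2 * u) * (1 - u))" by (rule mult_left_mono[OF _ x0])
        thus ?thesis using u by (simp add: pos_divide_le_eq mult.assoc)
      qed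
      also have "\<dots> = x + 2 * x * u" by (simp add: algebra_simps)
      also have "2 * x * u \<le> 2 * l * (l * d / (m - 1) + \<kappa> * real j / m)"
        using u u0 xL x0 by (intro mult_mono) auto
      finally have "exp (real M0 * D / (N - real M0 - D))
          \<le> exp (x + 2 * l * (l * d / (m - 1) + \<kappa> * real j / m))" by simp
      hence "exp (real M0 * D / (N - real M0 - D)) / B
          \<le> exp (x + 2 * l * (l * d / (m - 1) + \<kappa> * real j / m)) / B"
        using B1 by (intro divide_right_mono) auto
      also have "\<dots> = exp x / B * exp (2 * l * (l * d / (m - 1) + \<kappa> * real j / m))"
        by (simp add: exp_add)
      also have "\<dots> \<le> 1 / \<omega> * exp (2 * l * (l * d / (m - 1) + \<kappa> * real j / m))"
        by (rule mult_right_mono[OF expx]) simp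
      finally show ?thesis by simp
    qed
    finally show ?thesis by simp
  qed

  have T2: "measure_pmf.prob (hypergraph_process k n) {es. \<not> no_isolated j {1..n} (hypergraph_at es M1)}
      \<le> real j / m"
  proof -
    have "measure_pmf.prob (hypergraph_process k n) {es. \<not> no_isolated j {1..n} (hypergraph_at es M1)}
       \<le> B * exp (- (D * real M1 / N))"
      unfolding B_def D_def N_def by (rule prob_isolated_le) (use jk M1card in auto)
    also have "2 * L \<le> D * real M1 / N"
    proof -
      have "B / \<kappa> * (2 * L) * (D / N) \<le> real M1 * (D / N)" using M1 ge1 by (intro mult_right_mono) auto
      moreover have "B / \<kappa> * (2 * L) * (D / N) = 2 * L" unfolding DN using B1 ge1 by simp
      ultimately show ?thesis by (simp add: mult.commute)
    qed
    hence "B * exp (- (D * real M1 / N)) \<le> B * exp (- (2 * L))"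
      using B1 by (intro mult_left_mono) auto
    also have "\<dots> = 1 / B"
    proof -
      have "exp (- (2 * L)) = 1 / (exp L * exp L)" by (simp add: exp_minus field_simps flip: exp_add)
      also have "exp L = B" using B1 by (simp add: L_def)
      finally show ?thesis using B1 by simp
    qed
    also have "\<dots> \<le> 1 / (m / real j)" using Bm m2 j0 B1 by (intro divide_left_mono) auto
    finally show ?thesis by simp
  qed

  \<comment> \<open>Normalised so that a set of size \<open>s\<close> has
    \<open>s * \<alpha> s * D\<close> crossing edges, where \<open>D\<close> is the number of
    \<open>k\<close>-sets containing a given \<open>j\<close>-set.\<close>
  define \<alpha> where "\<alpha> s = real ((mm - s) choose (k - j)) / D" for s
  define t where "t s = (if real s ^ 4 \<le> m
      then real (s choose (k - j + 1)) * (exp (- (x * real s * \<alpha> s)) * (2 * real M1 / N))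
      else exp (- (x * real s * \<alpha> s)))" for s
  define ss where "ss = {s. 2 \<le> s \<and> 2 * s \<le> mm}"
  have Dmm: "D = real ((mm - 1) choose (k - j))" by (simp add: D_def mm1)
  have t: "measure_pmf.prob (hypergraph_process k n) (closed_with_edge j k n I M0 M1 S) \<le> t (card S)"
    if I: "I \<in> subsets_of_size (j - 1) {1..n}" and S: "S \<subseteq> {1..n} - I" "2 \<le> card S"
      "2 * card S \<le> n + 1 - j" for I S
  proof -
    define s where "s = card S"
    let ?w = "card S * ((n + 1 - j - card S) choose (k - j))"
    have w: "real ?w = real s * \<alpha> s * D" using ge1 by (simp add: \<alpha>_def s_def mm_def)
    have e: "real ?w * real M0 / N = x * real s * \<alpha> s" unfolding w by (simp add: x_def mult_ac)
    note b = prob_closed_with_edge_le[OF jk(1,2) _ M01 M1card I S(1), folded N_def, unfolded e]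
    show ?thesis
    proof (cases "real s ^ 4 \<le> m")
      case True
      \<comment> \<open>The crossing edges must be a small share of all \<open>k\<close>-sets: their
        number is at most \<open>s * D\<close>, and \<open>s <= sqrt m\<close>.\<close>
      have "4 * real ?w \<le> N"
      proof -
        have "(real s ^ 2) ^ 2 \<le> m" using True by (simp flip: power_mult)
        hence "real s ^ 2 \<le> sqrt m" by (rule real_le_rsqrt)
        moreover have "real s \<le> real s ^ 2" using S by (intro self_le_power) (auto simp: s_def)
        ultimately have "real s \<le> sqrt m" by linarith
        hence "4 * \<kappa> * real j * real s \<le> 4 * \<kappa> * real j * sqrt m"
          using ge1 j0 by (intro mult_left_mono) auto
        hence "4 * \<kappa> * real s * real j \<le> m" using \<kappa>s by (simp add: mult_ac)
        hence "4 * \<kappa> * real s \<le> m / real j" using j0 by (simp add: field_simps)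
        hence "4 * (\<kappa> / B) * real s \<le> 1" using Bm B1 by (simp add: field_simps)
        hence "4 * (D / N) * real s * N \<le> 1 * N" unfolding DN using ge1 by (intro mult_right_mono) auto
        hence sD: "4 * (real s * D) \<le> N" using ge1 by (simp add: mult_ac)
        have "\<alpha> s \<le> 1"
        proof -
          have "(mm - s) choose (k - j) \<le> (mm - 1) choose (k - j)"
            using S by (intro binomial_right_mono) (auto simp: s_def)
          hence "real ((mm - s) choose (k - j)) \<le> D" by (simp add: Dmm)
          thus ?thesis using ge1(3) by (simp add: \<alpha>_def)
        qed
        hence "real s * \<alpha> s * D \<le> real s * 1 * D" using ge1 by (intro mult_right_mono mult_left_mono) auto
        thus ?thesis unfolding w using sD by simp
      qed
      from b(2)[OF _ M1N4 this] True jk show ?thesis by (simp add: t_def s_def)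
    next
      case False
      with b(1) jk show ?thesis by (simp add: t_def s_def)
    qed
  qed
  have mainT: "measure_pmf.prob (hypergraph_process k n) {es. tau_c n j es \<noteq> tau_i n j es}
     \<le> measure_pmf.prob (hypergraph_process k n) {es. no_isolated j {1..n} (hypergraph_at es M0)}
      + measure_pmf.prob (hypergraph_process k n) {es. \<not> no_isolated j {1..n} (hypergraph_at es M1)}
      + (\<Sum>s\<in>ss. Q * real (mm choose s) * t s)"
    unfolding ss_def mm_def Q_def using jk by (intro prob_tau_neq_le t) auto

  let ?K = "12 * l * (sqrt m * d / (m - 1))"
  let ?R = "2 powr (- (m powr (1 / 4)))"
  have my: "m * y = 2 * \<omega> * real j" using m2 by (simp add: y_def)
  \<comment> \<open>Each summand is bounded by the sum of the two bounds for small and large sets,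
    so that the sum over \<open>s\<close> need not be split.\<close>
  have term_bound: "Q * real (mm choose s) * t s \<le> (m * y) ^ s / fact s * ?K + ?R" if s: "s \<in> ss" for s
  proof (cases "real s ^ 4 \<le> m")
    case True
    have s1: "1 \<le> s" "s < mm" using s by (auto simp: ss_def)
    have dmm: "k - j < mm" using m2 d1 by (simp add: mm d_def)
    have \<alpha>: "1 - (real s - 1) * real (k - j) / (m - 1) \<le> \<alpha> s"
      unfolding \<alpha>_def Dmm mm using s1 dmm jk by (intro choose_diff_ratio_ge) auto
    have "Q * real (mm choose s) * t s
        \<le> Q * (m ^ s / fact s) * (real s ^ (k - j + 1) * (exp (- (x * real s * \<alpha> s)) * (6 * L / D)))"
    proof (intro mult_mono)
      show "real (mm choose s) \<le> m ^ s / fact s" unfolding mm by (rule choose_le_power_over_fact)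
      have "s choose (k - j + 1) \<le> s ^ (k - j + 1)"
        using binomial_le_pow[of "k - j + 1" s] by (cases "k - j + 1 \<le> s") (auto simp: binomial_eq_0)
      hence "real (s choose (k - j + 1)) \<le> real s ^ (k - j + 1)" by (metis of_nat_le_iff of_nat_power)
      moreover have "2 * real M1 / N \<le> 6 * L / D" using M1N by simp
      ultimately have "real (s choose (k - j + 1)) * (exp (- (x * real s * \<alpha> s)) * (2 * real M1 / N))
         \<le> real s ^ (k - j + 1) * (exp (- (x * real s * \<alpha> s)) * (6 * L / D))"
        using ge1 by (intro mult_mono mult_left_mono) auto
      thus "t s \<le> real s ^ (k - j + 1) * (exp (- (x * real s * \<alpha> s)) * (6 * L / D))"
        using True by (simp add: t_def)
      show "0 \<le> t s" using True ge1 by (simp add: t_def)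
    qed (use ge1 m2 in auto)
    also have "\<dots> \<le> (m * y) ^ s / fact s * (12 * L * (sqrt m * real (k - j) / (m - 1)))"
    proof (rule small_term_le[OF ge1(1) x0 xL(1) expmx \<alpha> m2(1) True s1(1)])
      have "L * sqrt m * real (k - j) / (m - 1) \<le> l * sqrt m * d / (m - 1)"
        unfolding d_def using Ll m2 by (intro divide_right_mono mult_right_mono) auto
      thus "L * sqrt m * real (k - j) / (m - 1) \<le> ln 2" using ls by simp
    qed (use jk sm Dge in \<open>auto simp: d_def\<close>)
    also have "\<dots> \<le> (m * y) ^ s / fact s * ?K"
      unfolding d_def using Ll m2 my \<omega> by (intro mult_left_mono mult_right_mono) auto
    also have "\<dots> \<le> (m * y) ^ s / fact s * ?K + ?R" by simp
    finally show ?thesis .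
  next
    case False
    have s2: "2 \<le> s" "2 * s \<le> mm" using s by (auto simp: ss_def)
    have ms: "m powr (1 / 4) \<le> real s"
    proof -
      have "m powr (1 / 4) \<le> (real s ^ 4) powr (1 / 4)" using False m2 by (intro powr_mono2) auto
      also have "real s ^ 4 = real s powr 4" using s2 by simp
      also have "(real s powr 4) powr (1 / 4) = real s" unfolding powr_powr using s2 by simp
      finally show ?thesis .
    qed
    have mpos: "m powr (1 / 4) > 0" using m2 by simp
    have half: "Q * real (mm choose s) * t s \<le> (1 / 2) ^ s"
    \<comment> \<open>In this range \<alpha> is at least 7/8, while
      \<open>s >= m powr (1 / 4)\<close> reduces the count of sets to a power of order
      \<open>m powr (3 / 4)\<close>. As \<open>y\<close> is nearly of order \<open>1 / m\<close>,
      the exponent 7/8 beats 3/4.\<close>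
    proof (cases "8 * (k - j) * s \<le> mm")
      case True
      have "real (8 * (k - j) * s) \<le> real mm" using True by (subst of_nat_le_iff)
      hence "8 * d * real s \<le> m" by (simp add: d_def mm)
      hence "(real s - 1) * d \<le> 1 / 8 * (m - 1)" using d1 by (simp add: algebra_simps)
      hence "(real s - 1) * d / (m - 1) \<le> 1 / 8" using m2 by (simp add: pos_divide_le_eq)
      moreover have "1 - (real s - 1) * d / (m - 1) \<le> \<alpha> s"
        unfolding \<alpha>_def Dmm mm d_def using s2 m2 jk
        by (intro choose_diff_ratio_ge) (auto simp: mm d_def)
      ultimately have "7 / 8 \<le> \<alpha> s" by simp
      hence "Q * exp (- (x * real s * \<alpha> s)) \<le> (y powr (7 / 8)) ^ s"
        using s2 by (intro large_term_le ge1 x0 expmx) auto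
      moreover have "real (mm choose s) \<le> (exp 1 * m powr (3 / 4)) ^ s"
      proof -
        have "real (mm choose s) \<le> (exp 1 * m / real s) ^ s"
          unfolding mm using s2 by (intro choose_le_exp_power) auto
        also have "\<dots> \<le> (exp 1 * m / m powr (1 / 4)) ^ s"
          using ms mpos m2 s2 by (intro power_mono divide_left_mono) auto
        also have "exp 1 * m / m powr (1 / 4) = exp 1 * m powr (3 / 4)"
          using m2 powr_diff[of m 1 "1 / 4"] by simp
        finally show ?thesis .
      qed
      ultimately have "real (mm choose s) * (Q * exp (- (x * real s * \<alpha> s)))
          \<le> (exp 1 * m powr (3 / 4)) ^ s * (y powr (7 / 8)) ^ s"
        using ge1 by (intro mult_mono) auto
      also have "\<dots> = (exp 1 * m powr (3 / 4) * y powr (7 / 8)) ^ s" by (simp add: power_mult_distrib)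
      also have "\<dots> \<le> (1 / 2) ^ s" using big1 by (intro power_mono) auto
      finally show ?thesis using False by (simp add: t_def mult_ac)
    next
      \<comment> \<open>For \<open>s\<close> linear in \<open>m\<close> the crude count
        \<open>2 ^ mm\<close> is an \<open>s\<close>-th power of a constant, so any fixed positive
        power of \<open>y\<close> suffices.\<close>
      case big: False
      have "c0 \<le> \<alpha> s"
        unfolding \<alpha>_def Dmm c0_def d_def using s2 m2 jk
        by (intro choose_diff_ratio_ge_const) (auto simp: mm d_def)
      moreover have "c0 \<ge> 0" by (simp add: c0_def d1)
      moreover have "1 \<le> c0 * real s"
        using c0m mult_left_mono[OF ms \<open>c0 \<ge> 0\<close>] by simp
      ultimately have "Q * exp (- (x * real s * \<alpha> s)) \<le> (y powr c0) ^ s"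
        by (intro large_term_le ge1 x0 expmx) auto
      moreover have "real (mm choose s) \<le> (2 ^ (8 * (k - j))) ^ s"
      proof -
        have "mm choose s \<le> 2 ^ mm" by (rule binomial_le_pow2)
        hence "real (mm choose s) \<le> 2 ^ mm" by (metis of_nat_le_iff of_nat_numeral of_nat_power)
        also have "(2 :: real) ^ mm \<le> 2 ^ (8 * (k - j) * s)" using big by (intro power_increasing) auto
        finally show ?thesis by (simp only: power_mult)
      qed
      ultimately have "real (mm choose s) * (Q * exp (- (x * real s * \<alpha> s)))
          \<le> (2 ^ (8 * (k - j))) ^ s * (y powr c0) ^ s"
        using ge1 by (intro mult_mono) auto
      also have "\<dots> = (2 ^ (8 * (k - j)) * y powr c0) ^ s" by (simp only: power_mult_distrib)
      also have "\<dots> \<le> (1 / 2) ^ s" using big2 by (intro power_mono) auto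
      finally show ?thesis using False by (simp add: t_def mult_ac)
    qed
    also have "(1 / 2 :: real) ^ s = 2 powr (- real s)" by (simp add: powr_minus powr_realpow power_divide field_simps)
    also have "\<dots> \<le> ?R" using ms by simp
    also have "\<dots> \<le> (m * y) ^ s / fact s * ?K + ?R"
      using Ll L1 m2 my \<omega> d1 by auto
    finally show ?thesis .
  qed
  have finss: "finite ss" "card ss \<le> mm"
  proof -
    have "ss \<subseteq> {1..mm}" by (auto simp: ss_def)
    from card_mono[OF _ this] finite_subset[OF this] show "finite ss" "card ss \<le> mm" by auto
  qed
  have "(\<Sum>s\<in>ss. Q * real (mm choose s) * t s) \<le> (\<Sum>s\<in>ss. (m * y) ^ s / fact s * ?K + ?R)"
    by (intro sum_mono term_bound)
  also have "\<dots> = (\<Sum>s\<in>ss. (m * y) ^ s / fact s) * ?K + real (card ss) * ?R"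
    by (simp only: sum.distrib sum_constant sum_distrib_right)
  also have "\<dots> \<le> exp (m * y) * ?K + m * ?R"
    using finss my \<omega> Ll L1 m2 d1
    by (intro add_mono mult_right_mono sum_power_over_fact_le_exp) (auto simp: mm)
  finally have T3: "(\<Sum>s\<in>ss. Q * real (mm choose s) * t s) \<le> exp (2 * \<omega> * real j) * ?K + m * ?R"
    by (simp only: my)
  show ?thesis using mainT T1 T2 T3 by linarith
qed

section \<open>Passage to the limit\<close>

lemma prob_tau_neq_tendsto_0:
  assumes "1 \<le> j" "j < k"
  shows "(\<lambda>n. measure_pmf.prob (hypergraph_process k n) {es. tau_c n j es \<noteq> tau_i n j es}) \<longlonglongrightarrow> 0"
proof -
  \<comment> \<open>The limits are taken with these quantities as abstract constants, of which only
    positivity is supplied.\<close>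
  define J d K c0 where "J = real j" and "d = real (k - j)" and "K = real (k choose j)"
    and "c0 = (1 / (2 * d)) ^ (k - j)"
  have pos: "J > 0" "d > 0" "K > 0" using assms by (auto simp: J_def d_def K_def)
  hence c0: "c0 > 0" by (simp add: c0_def)
  define C :: real where "C = 2 ^ (8 * (k - j))"
  have C: "C > 0" by (simp add: C_def)
  let ?m = "\<lambda>n::nat. real n + 1 - J"
  define f where "f = (\<lambda>n::nat. exp (2 * (J * ln (real n)) * (J * ln (real n) * d / (?m n - 1) + K * J / ?m n)) / ln (ln (real n))
      + (exp (8 * d * (J * ln (real n)) / (?m n - 1)) - 1) + J / ?m n
      + (exp (2 * ln (ln (real n)) * J) * (12 * (J * ln (real n)) * (sqrt (?m n) * d / (?m n - 1)))
         + ?m n * 2 powr (- (?m n powr (1 / 4)))))"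
  have a1: "(\<lambda>n::nat. exp (2 * (J * ln (real n)) * (J * ln (real n) * d / (?m n - 1) + K * J / ?m n))
          / ln (ln (real n))) \<longlonglongrightarrow> 0"
    using pos by real_asymp
  have a2: "(\<lambda>n::nat. exp (8 * d * (J * ln (real n)) / (?m n - 1)) - 1) \<longlonglongrightarrow> 0"
    using pos by real_asymp
  have a3: "(\<lambda>n::nat. J / ?m n) \<longlonglongrightarrow> 0"
    using pos by real_asymp
  \<comment> \<open>The first factor is a fixed power of \<open>ln n\<close>, which the order
    \<open>1 / sqrt n\<close> of the last factor outweighs.\<close>
  have a4: "(\<lambda>n::nat. exp (2 * ln (ln (real n)) * J) * (12 * (J * ln (real n)) * (sqrt (?m n) * d / (?m n - 1)))) \<longlonglongrightarrow> 0"
    using pos by real_asymp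
  have a5: "(\<lambda>n::nat. ?m n * 2 powr (- (?m n powr (1 / 4)))) \<longlonglongrightarrow> 0"
    using pos by real_asymp
  have "f \<longlonglongrightarrow> 0 + 0 + 0 + (0 + 0)" unfolding f_def by (intro tendsto_add a1 a2 a3 a4 a5)
  hence f0: "f \<longlonglongrightarrow> 0" by simp
  have "eventually (\<lambda>n. 2 * k \<le> n) sequentially" by (rule eventually_ge_at_top)
  moreover have "eventually (\<lambda>n::nat. 1 \<le> ln (ln (real n))) sequentially" by real_asymp
  moreover have "eventually (\<lambda>n::nat. ln (ln (real n)) \<le> ?m n / J) sequentially" using pos by real_asymp
  moreover have "eventually (\<lambda>n::nat. exp 1 \<le> ?m n / J) sequentially" using pos by real_asymp
  moreover have "eventually (\<lambda>n::nat. 8 * K * J \<le> ?m n) sequentially" using pos by real_asymp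
  moreover have "eventually (\<lambda>n::nat. 12 * (J * ln (real n)) * d \<le> ?m n - 1) sequentially"
    using pos by real_asymp
  moreover have "eventually (\<lambda>n::nat. 4 * K * J * sqrt (?m n) \<le> ?m n) sequentially" using pos by real_asymp
  moreover have "eventually (\<lambda>n::nat. J * ln (real n) * sqrt (?m n) * d / (?m n - 1) \<le> ln 2) sequentially"
    using pos by real_asymp
  moreover have "eventually (\<lambda>n::nat. sqrt (?m n) * d / (?m n - 1) \<le> 1) sequentially"
    using pos by real_asymp
  moreover have "eventually (\<lambda>n::nat. exp 1 * ?m n powr (3 / 4)
      * (2 * ln (ln (real n)) * J / ?m n) powr (7 / 8) \<le> 1 / 2) sequentially"
    using pos by real_asymp
  moreover have "eventually (\<lambda>n::nat. C * (2 * ln (ln (real n)) * J / ?m n) powr c0 \<le> 1 / 2) sequentially"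
    using pos c0 C by real_asymp
  moreover have "eventually (\<lambda>n::nat. 1 \<le> c0 * ?m n powr (1 / 4)) sequentially"
    using pos c0 by real_asymp
  ultimately have "eventually (\<lambda>n. measure_pmf.prob (hypergraph_process k n) {es. tau_c n j es \<noteq> tau_i n j es} \<le> f n) sequentially"
  proof eventually_elim
    case (elim n)
    show ?case unfolding f_def J_def d_def K_def
      by (rule prob_tau_neq_explicit)
         (use assms elim in \<open>simp_all add: J_def d_def K_def c0_def C_def\<close>)
  qed
  from tendsto_sandwich[OF _ this tendsto_const f0] show ?thesis by simp
qed

theorem theorem1p1:
  fixes k j :: nat
  assumes "3 \<le> k" and "1 \<le> j" and "j \<le> k - 1"
  shows "(\<lambda>n. measure_pmf.prob (hypergraph_process k n) {es. tau_c n j es = tau_i n j es})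
           \<longlonglongrightarrow> 1"
proof -
  have "measure_pmf.prob (hypergraph_process k n) {es. tau_c n j es = tau_i n j es}
      = 1 - measure_pmf.prob (hypergraph_process k n) {es. tau_c n j es \<noteq> tau_i n j es}" for n
    using measure_pmf.prob_compl[of "{es. tau_c n j es \<noteq> tau_i n j es}" "hypergraph_process k n"]
    by (simp add: Collect_neg_eq[symmetric] Compl_eq_Diff_UNIV[symmetric])
  moreover have "(\<lambda>n. 1 - measure_pmf.prob (hypergraph_process k n) {es. tau_c n j es \<noteq> tau_i n j es})
      \<longlonglongrightarrow> 1 - 0"
    by (intro tendsto_diff tendsto_const prob_tau_neq_tendsto_0) (use assms in auto)
  ultimately show ?thesis by simp
qed

end
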